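(* Let $1/q$ be a prime power, $\Bbbk=\mathbb{F}_{1/q}$, $\alpha=(\alpha_1,\dots,\alpha_k)$, $\beta=(\beta_1,\dots,\beta_l)$ weak compositions of $n$, and $M\in\mathbb{N}^{k\times l}$ with row sums $\alpha$ and column sums $\beta$. Then $$\sum_{[V]}\frac{1}{|\mathrm{Aut}(V)|}=\frac{q^{n+n(\alpha)+n(\beta)}(1-q)^{-n}}{\prod_{i,j}[M_{i,j}]_q!},$$ where the sum runs over isomorphism classes of finite-dimensional $\Pi(Q(k,l))$-modules $V$ whose restriction to a $\Bbbk Q(k,l)$-module is isomorphic to $V_M$.
   Context: $n(\alpha)=\sum\binom{\alpha_i}2$, $[m]_q!=\prod_{r\le m}(1+\cdots+q^{r-1})$. $Q(k,l)$ is the quiver with vertices $k-1,k-2,\dots,1,0,-1,\dots,-l+1$ and arrows $i\to i-1$ for $1\le i\le k-1$ and $i\to i+1$ for $-l+1\le i\le-1$ (all pointing toward $0$). The double quiver adds a reverse arrow $\bar a$ for each arrow $a$. A $\Pi(Q(k,l))$-module (preprojective algebra module) is a representation $V$ of the double quiver (finite-dimensional spaces $V(i)$ and linear maps $V(a)$, $V(\bar a)$) satisfying, at every vertex $i$, $\sum_{a:\,s(a)=i}V(\bar a)V(a)=\sum_{a:\,t(a)=i}V(a)V(\bar a)$, where $s,t$ are source and target. Restriction to $\Bbbk Q(k,l)$ forgets the maps $V(\bar a)$. For $1\le i\le k$, $1\le j\le l$, $V_{i,j}$ is the representation of $Q(k,l)$ with $V_{i,j}(v)=\Bbbk$ for $k-i\ge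 v\ge -l+j$ and $0$ otherwise, each arrow between two vertices in this range acting by the identity and others by $0$; $V_M=\bigoplus_{i,j}V_{i,j}^{\oplus M_{i,j}}$. $\mathrm{Aut}(V)$ is the group of module automorphisms. *)

theory Defs
  imports Complex_Main "Jordan_Normal_Form.Matrix"
begin

text \<open>Quiver Q(k,l): vertices -l+1,...,k-1; each vertex w <> 0 is the source of
exactly one arrow a_w : w -> tgt w (pointing toward 0). A representation of the
double quiver with V(v) = field^(d v) is a pair (A,B): A w is the matrix of V(a_w)
(size d(tgt w) x d w), B w the matrix of V(reverse of a_w) (size d w x d(tgt w)).\<close>

definition vert :: "nat \<Rightarrow> nat \<Rightarrow> int set" where
  "vert k l = {- int l + 1 .. int k - 1}"

definition arrs :: "nat \<Rightarrow> nat \<Rightarrow> int set" where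
  "arrs k l = vert k l - {0}"

definition tgt :: "int \<Rightarrow> int" where
  "tgt w = (if w > 0 then w - 1 else w + 1)"

type_synonym 'a qrep = "int \<Rightarrow> 'a mat"
type_synonym 'a dqrep = "(int \<Rightarrow> 'a mat) \<times> (int \<Rightarrow> 'a mat)"

definition is_qrep :: "nat \<Rightarrow> nat \<Rightarrow> (int \<Rightarrow> nat) \<Rightarrow> 'a::field qrep \<Rightarrow> bool" where
  "is_qrep k l d A \<longleftrightarrow>
     (\<forall>w\<in>arrs k l. A w \<in> carrier_mat (d (tgt w)) (d w)) \<and>
     (\<forall>w. w \<notin> arrs k l \<longrightarrow> A w = 0\<^sub>m 0 0)"

text \<open>Sum over arrows with source v of V(abar)V(a), and over arrows with target v
of V(a)V(abar). The arrows with target v are v+1 (if v >= 0) and v-1 (if v <= 0),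
whenever these are vertices.\<close>
definition out_term :: "nat \<Rightarrow> nat \<Rightarrow> (int \<Rightarrow> nat) \<Rightarrow> 'a::field dqrep \<Rightarrow> int \<Rightarrow> 'a mat" where
  "out_term k l d V v =
     (if v \<in> arrs k l then snd V v * fst V v else 0\<^sub>m (d v) (d v))"

definition in_term :: "nat \<Rightarrow> nat \<Rightarrow> (int \<Rightarrow> nat) \<Rightarrow> 'a::field dqrep \<Rightarrow> int \<Rightarrow> 'a mat" where
  "in_term k l d V v =
     (if v + 1 \<in> arrs k l \<and> tgt (v + 1) = v then fst V (v + 1) * snd V (v + 1)
      else 0\<^sub>m (d v) (d v)) +
     (if v - 1 \<in> arrs k l \<and> tgt (v - 1) = v then fst V (v - 1) * snd V (v - 1)
      else 0\<^sub>m (d v) (d v))"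

definition is_pimod :: "nat \<Rightarrow> nat \<Rightarrow> (int \<Rightarrow> nat) \<Rightarrow> 'a::field dqrep \<Rightarrow> bool" where
  "is_pimod k l d V \<longleftrightarrow>
     is_qrep k l d (fst V) \<and>
     (\<forall>w\<in>arrs k l. snd V w \<in> carrier_mat (d w) (d (tgt w))) \<and>
     (\<forall>w. w \<notin> arrs k l \<longrightarrow> snd V w = 0\<^sub>m 0 0) \<and>
     (\<forall>v\<in>vert k l. out_term k l d V v = in_term k l d V v)"

definition gl_fam :: "nat \<Rightarrow> nat \<Rightarrow> (int \<Rightarrow> nat) \<Rightarrow> (int \<Rightarrow> 'a::field mat) \<Rightarrow> bool" where
  "gl_fam k l d g \<longleftrightarrow>
     (\<forall>v\<in>vert k l. g v \<in> carrier_mat (d v) (d v) \<and> invertible_mat (g v)) \<and>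
     (\<forall>v. v \<notin> vert k l \<longrightarrow> g v = 0\<^sub>m 0 0)"

definition qhom_by :: "nat \<Rightarrow> nat \<Rightarrow> (int \<Rightarrow> 'a::field mat) \<Rightarrow> 'a qrep \<Rightarrow> 'a qrep \<Rightarrow> bool" where
  "qhom_by k l g A A' \<longleftrightarrow> (\<forall>w\<in>arrs k l. g (tgt w) * A w = A' w * g w)"

definition qrep_iso :: "nat \<Rightarrow> nat \<Rightarrow> (int \<Rightarrow> nat) \<Rightarrow> 'a::field qrep \<Rightarrow> 'a qrep \<Rightarrow> bool" where
  "qrep_iso k l d A A' \<longleftrightarrow> (\<exists>g. gl_fam k l d g \<and> qhom_by k l g A A')"

definition dhom_by :: "nat \<Rightarrow> nat \<Rightarrow> (int \<Rightarrow> 'a::field mat) \<Rightarrow> 'a dqrep \<Rightarrow> 'a dqrep \<Rightarrow> bool" where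
  "dhom_by k l g V V' \<longleftrightarrow> qhom_by k l g (fst V) (fst V') \<and>
     (\<forall>w\<in>arrs k l. g w * snd V w = snd V' w * g (tgt w))"

definition pimod_iso :: "nat \<Rightarrow> nat \<Rightarrow> (int \<Rightarrow> nat) \<Rightarrow> 'a::field dqrep \<Rightarrow> 'a dqrep \<Rightarrow> bool" where
  "pimod_iso k l d V V' \<longleftrightarrow> (\<exists>g. gl_fam k l d g \<and> dhom_by k l g V V')"

definition Aut :: "nat \<Rightarrow> nat \<Rightarrow> (int \<Rightarrow> nat) \<Rightarrow> 'a::field dqrep \<Rightarrow> (int \<Rightarrow> 'a mat) set" where
  "Aut k l d V = {g. gl_fam k l d g \<and> dhom_by k l g V V}"

text \<open>The representation V_M = sum of V_{i,j}^{M i j}: basis of V_M(v) is labelled by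
triples (i,j,c), c < M i j, with k-i >= v >= -l+j.\<close>
definition VM_basis :: "nat \<Rightarrow> nat \<Rightarrow> (nat \<Rightarrow> nat \<Rightarrow> nat) \<Rightarrow> int \<Rightarrow> (nat \<times> nat \<times> nat) list" where
  "VM_basis k l M v = [(i, j, c). i \<leftarrow> [1..<k+1], j \<leftarrow> [1..<l+1], c \<leftarrow> [0..<M i j],
      - int l + int j \<le> v \<and> v \<le> int k - int i]"

definition VM_dim :: "nat \<Rightarrow> nat \<Rightarrow> (nat \<Rightarrow> nat \<Rightarrow> nat) \<Rightarrow> int \<Rightarrow> nat" where
  "VM_dim k l M v = length (VM_basis k l M v)"

definition VM :: "nat \<Rightarrow> nat \<Rightarrow> (nat \<Rightarrow> nat \<Rightarrow> nat) \<Rightarrow> 'a::field qrep" where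
  "VM k l M w = (if w \<in> arrs k l then
      mat (VM_dim k l M (tgt w)) (VM_dim k l M w)
        (\<lambda>(r, s). if VM_basis k l M (tgt w) ! r = VM_basis k l M w ! s then 1 else 0)
    else 0\<^sub>m 0 0)"

text \<open>Pi(Q(k,l))-modules (in coordinates) whose restriction to Q(k,l) is isomorphic to V_M.
Any such module has dimension vector VM_dim, so all isomorphism classes are represented.\<close>
definition mods_over :: "nat \<Rightarrow> nat \<Rightarrow> (nat \<Rightarrow> nat \<Rightarrow> nat) \<Rightarrow> 'a::field itself \<Rightarrow> 'a dqrep set" where
  "mods_over k l M _ = {V. is_pimod k l (VM_dim k l M) V \<and>
      qrep_iso k l (VM_dim k l M) (fst V) (VM k l M)}"

definition iso_classes :: "nat \<Rightarrow> nat \<Rightarrow> (nat \<Rightarrow> nat \<Rightarrow> nat) \<Rightarrow> 'a::field itself \<Rightarrow> 'a dqrep set set" where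
  "iso_classes k l M T = mods_over k l M T //
     {(V, V'). V \<in> mods_over k l M T \<and> V' \<in> mods_over k l M T \<and>
        pimod_iso k l (VM_dim k l M) V V'}"

definition mass :: "nat \<Rightarrow> nat \<Rightarrow> (nat \<Rightarrow> nat \<Rightarrow> nat) \<Rightarrow> 'a::field itself \<Rightarrow> real" where
  "mass k l M T = (\<Sum>C\<in>iso_classes k l M T.
      1 / real (card (Aut k l (VM_dim k l M) (SOME V. V \<in> C))))"

definition nbin :: "(nat \<Rightarrow> nat) \<Rightarrow> nat \<Rightarrow> nat" where
  "nbin a m = (\<Sum>i=1..m. a i choose 2)"

definition qfact :: "real \<Rightarrow> nat \<Rightarrow> real" where
  "qfact q m = (\<Prod>r=1..m. \<Sum>s<r. q ^ s)"

end

theory Submission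
  imports Defs "Jordan_Normal_Form.Determinant" "HOL-Library.FuncSet" "HOL-Library.Cardinality"
begin

text \<open>
  The group \<open>G = \<Prod>\<^sub>v GL(d v)\<close> acts on the modules in question, and by orbit counting the sum of
  \<open>1 / |Aut V|\<close> is \<open>|X| / |G|\<close> for the set \<open>X\<close> of all such modules in coordinates. The
  representations isomorphic to \<open>V\<^sub>M\<close> form one orbit of size \<open>|G| / |Aut V\<^sub>M|\<close>. Over each of them the
  module structures form the annihilator of the image of
  \<open>g \<mapsto> (g (tgt w) A w - A w g w)\<^sub>w\<close> under the trace pairing; hence their number is \<open>|End V\<^sub>M|\<close>
  divided by the field size to the power of the Euler form of the dimension vector, which is
  \<open>n + n(\<alpha>) + n(\<beta>)\<close>. Finally, \<open>End V\<^sub>M\<close> is the algebra of \<open>n \<times> n\<close> matrices that are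
  block triangular for the product order on the pairs \<open>(i, j)\<close> with blocks of sizes \<open>M i j\<close>, so a
  fraction \<open>\<Prod>\<^sub>i\<^sub>j \<Prod>\<^sub>r (1 - q\<^sup>r)\<close>, with \<open>r\<close> from 1 to \<open>M i j\<close>, of its elements is invertible.
\<close>

section \<open>Invertible elements of incidence algebras over finite fields\<close>

text \<open>Write Q = 1/q and E for the Euler form. The counts multiply to |X| / |G| = |End VM| /
  (|Aut VM| Q^E), so |G| cancels and only the proportion of units in the endomorphism algebra
  matters; its order never has to be evaluated. To find this proportion, one index at a time is
  removed. The algebra and its unit set acquire the same factors except at the column of the removed
  index, where the zero column is excluded: Q^m becomes Q^m - 1, with m the current size of the
  block. A block of size m thus yields the product of 1 - q^r for r up to m, which is [m]_q!
  (1-q)^m. The block sizes add up to n, whence the factor (1-q)^(-n). The same group G acts twice: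
  on modules, where the stabilizers are the groups Aut V of the sum, and on quiver representations,
  where the orbit of VM is the base over which the module structures are counted. The fibres have
  equal size because the endomorphism count is constant along the orbit.\<close>

lemma card_zero_outside:
  assumes "finite A"
  shows "finite {f :: 'b \<Rightarrow> 'a::{finite,zero}. \<forall>x. x \<notin> A \<longrightarrow> f x = 0}"
    and "card {f :: 'b \<Rightarrow> 'a::{finite,zero}. \<forall>x. x \<notin> A \<longrightarrow> f x = 0} = CARD('a) ^ card A"
proof -
  let ?Z = "{f :: 'b \<Rightarrow> 'a. \<forall>x. x \<notin> A \<longrightarrow> f x = 0}"
  have "bij_betw (\<lambda>f. restrict f A) ?Z (A \<rightarrow>\<^sub>E UNIV)"
    by (rule bij_betw_byWitness[where f' = "\<lambda>f x. if x \<in> A then f x else 0"])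
      (auto simp: fun_eq_iff PiE_def extensional_def)
  then show "finite ?Z" "card ?Z = CARD('a) ^ card A"
    using assms by (auto simp: bij_betw_same_card card_funcsetE bij_betw_finite finite_PiE)
qed

text \<open>The incidence algebra of R on S. Its matrices are indexed by the whole type and vanish
  off S, so deleting an index from S keeps the type.\<close>

definition inc :: "'b set \<Rightarrow> ('b \<Rightarrow> 'b \<Rightarrow> bool) \<Rightarrow> ('b \<Rightarrow> 'b \<Rightarrow> 'a::zero) set" where
  "inc S R = {g. \<forall>x y. g x y \<noteq> 0 \<longrightarrow> x \<in> S \<and> y \<in> S \<and> R x y}"

text \<open>Invertibility of a square matrix over a field, expressed by its kernel because that form
  passes directly through row operations and the deletion of an index.\<close>

definition triv_ker :: "'b set \<Rightarrow> ('b \<Rightarrow> 'b \<Rightarrow> 'a::semiring_0) \<Rightarrow> bool" where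
  "triv_ker S g \<longleftrightarrow> (\<forall>f. (\<forall>x\<in>S. (\<Sum>y\<in>S. g x y * f y) = 0) \<longrightarrow> (\<forall>x\<in>S. f x = 0))"

definition inc_units :: "'b set \<Rightarrow> ('b \<Rightarrow> 'b \<Rightarrow> bool) \<Rightarrow> ('b \<Rightarrow> 'b \<Rightarrow> 'a::semiring_0) set" where
  "inc_units S R = {g \<in> inc S R. triv_ker S g}"

lemma card_inc:
  assumes "finite S"
  shows "finite (inc S R :: ('b \<Rightarrow> 'b \<Rightarrow> 'a::{finite,zero}) set)"
    and "card (inc S R :: ('b \<Rightarrow> 'b \<Rightarrow> 'a::{finite,zero}) set)
      = CARD('a) ^ card {(x, y). x \<in> S \<and> y \<in> S \<and> R x y}"
proof -
  let ?P = "{(x, y). x \<in> S \<and> y \<in> S \<and> R x y}"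
  have fin: "finite ?P"
    by (rule finite_subset[of _ "S \<times> S"]) (use assms in auto)
  have "bij_betw case_prod (inc S R :: ('b \<Rightarrow> 'b \<Rightarrow> 'a) set) {f. \<forall>x. x \<notin> ?P \<longrightarrow> f x = 0}"
    by (rule bij_betw_byWitness[where f' = curry]) (simp_all add: inc_def image_subset_iff, blast+)
  with card_zero_outside[OF fin, where 'a = 'a]
  show "finite (inc S R :: ('b \<Rightarrow> 'b \<Rightarrow> 'a) set)"
    "card (inc S R :: ('b \<Rightarrow> 'b \<Rightarrow> 'a) set) = CARD('a) ^ card ?P"
    by (auto simp: bij_betw_same_card bij_betw_finite)
qed

text \<open>This is (I - c a^T) g, a rank-one modification of the identity applied from the
  left.\<close>

definition rowop :: "'b set \<Rightarrow> ('b \<Rightarrow> 'a::field) \<Rightarrow> ('b \<Rightarrow> 'a) \<Rightarrow> ('b \<Rightarrow> 'b \<Rightarrow> 'a) \<Rightarrow> 'b \<Rightarrow> 'b \<Rightarrow> 'a" where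
  "rowop S a c g x z = g x z - c x * (\<Sum>p\<in>S. a p * g p z)"

text \<open>If (I - c a^T) v = 0, then v = c a(v); applying a gives a(v) = a(c) a(v), so a(c)
  different from 1 forces a(v) = 0 and v = 0.\<close>

lemma triv_ker_rowop:
  assumes nz: "(\<Sum>p\<in>S. a p * c p) \<noteq> 1"
  shows "triv_ker S (rowop S a c g) \<longleftrightarrow> triv_ker S g"
proof -
  define h where "h v x = v x - c x * (\<Sum>p\<in>S. a p * v p)" for v x
  have apply_h: "(\<Sum>z\<in>S. rowop S a c g x z * f z) = h (\<lambda>x. \<Sum>z\<in>S. g x z * f z) x" for f x
  proof -
    have "(\<Sum>z\<in>S. c x * (\<Sum>p\<in>S. a p * g p z) * f z)
        = c x * (\<Sum>z\<in>S. \<Sum>p\<in>S. a p * g p z * f z)"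
      by (simp add: sum_distrib_left sum_distrib_right mult.assoc)
    also have "(\<Sum>z\<in>S. \<Sum>p\<in>S. a p * g p z * f z) = (\<Sum>p\<in>S. \<Sum>z\<in>S. a p * g p z * f z)"
      by (rule sum.swap)
    finally show ?thesis
      by (simp add: rowop_def h_def left_diff_distrib sum_subtractf sum_distrib_left mult.assoc)
  qed
  have inj: "(\<forall>x\<in>S. h v x = 0) \<longleftrightarrow> (\<forall>x\<in>S. v x = 0)" for v
  proof
    let ?l = "\<Sum>p\<in>S. a p * v p"
    assume 0: "\<forall>x\<in>S. h v x = 0"
    then have v: "v x = c x * ?l" if "x \<in> S" for x
      using that by (simp add: h_def)
    have "?l = (\<Sum>p\<in>S. a p * (c p * ?l))"
      by (rule sum.cong) (use v in auto)
    also have "\<dots> = (\<Sum>p\<in>S. a p * c p) * ?l"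
      by (simp add: sum_distrib_right mult.assoc)
    finally have "?l = 0"
      using nz by simp
    then show "\<forall>x\<in>S. v x = 0"
      using v by simp
  qed (simp add: h_def)
  show ?thesis
    unfolding triv_ker_def apply_h inj ..
qed

text \<open>The rows other than y do not involve \<open>f y\<close>, and row y can be solved for
  \<open>f y\<close>, so kernel vectors on S and on S - {y} determine each other.\<close>

lemma triv_ker_unit_column:
  fixes g :: "'b \<Rightarrow> 'b \<Rightarrow> 'a::field"
  assumes "finite S" "y \<in> S" and col: "\<And>x. g x y = (if x = y then 1 else 0)"
  shows "triv_ker S g \<longleftrightarrow> triv_ker (S - {y}) g"
proof
  have split: "(\<Sum>z\<in>S. g x z * f z) = g x y * f y + (\<Sum>z\<in>S-{y}. g x z * f z)" for x f
    using assms by (simp add: sum.remove)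
  show "triv_ker (S - {y}) g" if t: "triv_ker S g"
    unfolding triv_ker_def
  proof (intro allI impI)
    fix f assume f: "\<forall>x\<in>S - {y}. (\<Sum>z\<in>S-{y}. g x z * f z) = 0"
    define f' where "f' = f(y := - (\<Sum>z\<in>S-{y}. g y z * f z))"
    have f': "(\<Sum>z\<in>S-{y}. g x z * f' z) = (\<Sum>z\<in>S-{y}. g x z * f z)" for x
      by (rule sum.cong) (auto simp: f'_def)
    have "\<forall>x\<in>S. (\<Sum>z\<in>S. g x z * f' z) = 0"
      unfolding split f' using f by (auto simp: col f'_def)
    then have "\<forall>x\<in>S. f' x = 0"
      using t by (simp add: triv_ker_def)
    then show "\<forall>x\<in>S - {y}. f x = 0"
      by (metis DiffE f'_def fun_upd_other insertI1)
  qed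
  show "triv_ker S g" if t: "triv_ker (S - {y}) g"
    unfolding triv_ker_def
  proof (intro allI impI)
    fix f assume f: "\<forall>x\<in>S. (\<Sum>z\<in>S. g x z * f z) = 0"
    have 1: "(\<Sum>z\<in>S-{y}. g x z * f z) = 0" if "x \<in> S - {y}" for x
      using f[rule_format, of x] that unfolding split by (simp add: col)
    have *: "\<forall>x\<in>S-{y}. f x = 0"
      using t 1 by (simp add: triv_ker_def)
    have "f y = 0"
      using bspec[OF f \<open>y \<in> S\<close>] * unfolding split by (simp add: col)
    with * show "\<forall>x\<in>S. f x = 0"
      by auto
  qed
qed

lemma triv_ker_cong:
  assumes "\<And>x y. x \<in> S \<Longrightarrow> y \<in> S \<Longrightarrow> g x y = g' x y"
  shows "triv_ker S g \<longleftrightarrow> triv_ker S g'"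
proof -
  have "(\<Sum>y\<in>S. g x y * f y) = (\<Sum>y\<in>S. g' x y * f y)" if "x \<in> S" for x f
    by (rule sum.cong) (use that assms in auto)
  then show ?thesis
    unfolding triv_ker_def by simp
qed

text \<open>Sort the invertible matrices by their column at the minimal index \<open>y\<close>. Every nonzero
  column occurs equally often, and a matrix whose column at \<open>y\<close> is the unit vector is invertible
  exactly when its minor without \<open>y\<close> is.\<close>

lemma card_inc_units_remove:
  fixes S :: "'b set" and y :: 'b
  assumes S: "finite S" "y \<in> S" and R: "reflp R" "transp R"
    and min: "\<And>x. x \<in> S \<Longrightarrow> R x y \<Longrightarrow> R y x"
  shows "card (inc_units S R :: ('b \<Rightarrow> 'b \<Rightarrow> 'a::{finite,field}) set)
    = (CARD('a) ^ card {x\<in>S. R x y} - 1) * CARD('a) ^ card {z\<in>S-{y}. R y z}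
      * card (inc_units (S - {y}) R :: ('b \<Rightarrow> 'b \<Rightarrow> 'a) set)"
proof -
  define C where "C = {x\<in>S. R x y}"
  have yC: "y \<in> C" and CS: "C \<subseteq> S" "finite C"
    using S R by (auto simp: C_def reflp_def)
  define e :: "'b \<Rightarrow> 'a" where "e x = (if x = y then 1 else 0)" for x
  define U where "U = {u :: 'b \<Rightarrow> 'a. \<forall>x. x \<notin> C \<longrightarrow> u x = 0} - {\<lambda>_. 0}"
  define L where "L u = {g \<in> inc_units S R. \<forall>x. g x y = u x}" for u :: "'b \<Rightarrow> 'a"
  have finS: "finite (inc_units S R :: ('b \<Rightarrow> 'b \<Rightarrow> 'a) set)"
    using card_inc(1)[OF S(1), of R, where 'a = 'a] by (simp add: inc_units_def)
  have finU: "finite U" and cardU: "card U = CARD('a) ^ card C - 1"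
    using card_zero_outside[OF CS(2), where 'a = 'a] by (auto simp: U_def)
  have union: "inc_units S R = (\<Union>u\<in>U. L u)"
  proof
    show "inc_units S R \<subseteq> (\<Union>u\<in>U. L u)"
    proof
      fix g :: "'b \<Rightarrow> 'b \<Rightarrow> 'a" assume g: "g \<in> inc_units S R"
      have "(\<lambda>x. g x y) \<noteq> (\<lambda>_. 0)"
      proof
        assume "(\<lambda>x. g x y) = (\<lambda>_. 0)"
        then have "(\<Sum>z\<in>S. g x z * e z) = 0" for x
          by (intro sum.neutral) (auto simp: e_def dest: fun_cong)
        then have "\<forall>x\<in>S. e x = 0"
          using g by (auto simp: inc_units_def triv_ker_def)
        then show False
          using S by (auto simp: e_def)
      qed
      then have "(\<lambda>x. g x y) \<in> U"
        using g by (auto simp: U_def C_def inc_units_def inc_def)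
      moreover have "g \<in> L (\<lambda>x. g x y)"
        using g by (simp add: L_def)
      ultimately show "g \<in> (\<Union>u\<in>U. L u)"
        by blast
    qed
  qed (auto simp: L_def)
  have col: "card (L u) = card (L e)" if u: "u \<in> U" for u
  proof -
    \<comment> \<open>The support of a must lie in C, the class of y: a row in C may receive other
      rows from C without leaving \<open>inc S R\<close>, by transitivity and minimality of y. If u
      vanishes at y, the coordinate at y is added to a functional that normalizes u, making
      \<open>a y\<close> nonzero without changing a(u).\<close>
    obtain a where a: "(\<Sum>p\<in>S. a p * u p) = 1" "a y \<noteq> 0" "\<And>p. p \<notin> C \<Longrightarrow> a p = 0"
    proof (cases "u y = 0")
      case True
      obtain p0 where p0: "u p0 \<noteq> 0" "p0 \<in> C"
        using u unfolding U_def fun_eq_iff by blast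
      have "(\<Sum>p\<in>S. (if p = p0 then 1 / u p0 else if p = y then 1 else 0) * u p)
          = (\<Sum>p\<in>S. if p = p0 then 1 else 0)"
        by (rule sum.cong) (use p0 True in auto)
      also have "\<dots> = 1"
        using S p0 CS by auto
      finally show ?thesis
        by (rule that) (use p0 True yC in auto)
    next
      case False
      have "(\<Sum>p\<in>S. (if p = y then 1 / u y else 0) * u p) = (\<Sum>p\<in>S. if p = y then 1 else 0)"
        by (rule sum.cong) (use False in auto)
      also have "\<dots> = 1"
        using S by auto
      finally show ?thesis
        by (rule that) (use False yC in auto)
    qed
    txt \<open>The row operation \<open>v \<mapsto> v - (u - e) \<cdot> a(v)\<close> sends \<open>u\<close> to \<open>e\<close> because \<open>a(u) = 1\<close>,
      and it is invertible because \<open>a(e) = a y \<noteq> 0\<close>.\<close>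
    define c where "c x = u x - e x" for x
    \<comment> \<open>From the inverse of a rank-one modification, I + c a^T / (1 - a(c)), where 1 -
      a(c) = \<open>a y\<close>.\<close>
    define c' where "c' x = - c x / a y" for x
    have ae: "(\<Sum>p\<in>S. a p * e p) = a y"
      using S by (simp add: e_def if_distrib cong: if_cong)
    have ac: "(\<Sum>p\<in>S. a p * c p) = 1 - a y"
      using a ae by (simp add: c_def right_diff_distrib sum_subtractf)
    have ac': "(\<Sum>p\<in>S. a p * c' p) = 1 - 1 / a y"
    proof -
      have "(\<Sum>p\<in>S. a p * c' p) = - (\<Sum>p\<in>S. a p * c p) / a y"
        by (simp add: c'_def sum_negf sum_divide_distrib)
      then show ?thesis
        using ac a(2) by (simp add: field_simps)
    qed
    have units: "rowop S a b g \<in> inc_units S R"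
      if g: "g \<in> inc_units S R" and b: "\<And>x. x \<notin> C \<Longrightarrow> b x = 0" "(\<Sum>p\<in>S. a p * b p) \<noteq> 1"
      for g b
    proof -
      have "rowop S a b g \<in> inc S R"
        unfolding inc_def
      proof (intro CollectI allI impI)
        fix x z assume nz: "rowop S a b g x z \<noteq> 0"
        show "x \<in> S \<and> z \<in> S \<and> R x z"
        proof (cases "g x z = 0")
          case True
          then have "b x \<noteq> 0" and "(\<Sum>p\<in>S. a p * g p z) \<noteq> 0"
            using nz by (auto simp: rowop_def)
          then obtain p where p: "p \<in> S" "a p \<noteq> 0" "g p z \<noteq> 0"
            by (auto elim: sum.not_neutral_contains_not_neutral)
          have "x \<in> C" "p \<in> C"
            using b(1) a(3) p \<open>b x \<noteq> 0\<close> by blast+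
          moreover have "R p z" "z \<in> S"
            using g p by (auto simp: inc_units_def inc_def)
          ultimately show ?thesis
            using min R(2) unfolding C_def by (blast dest: transpD)
        next
          case False
          then show ?thesis
            using g by (auto simp: inc_units_def inc_def)
        qed
      qed
      then show ?thesis
        using g b(2) by (simp add: inc_units_def triv_ker_rowop)
    qed
    have c0: "c x = 0" "c' x = 0" if "x \<notin> C" for x
      using that u yC by (auto simp: c_def c'_def U_def e_def)
    have lin: "(\<Sum>p\<in>S. a p * rowop S a b g p z) = (\<Sum>p\<in>S. a p * g p z) * (1 - (\<Sum>p\<in>S. a p * b p))"
      for b g z
      by (simp add: rowop_def right_diff_distrib sum_subtractf mult.assoc[symmetric] sum_distrib_right[symmetric])
    have "bij_betw (rowop S a c) (L u) (L e)"
    proof (rule bij_betw_byWitness[where f' = "rowop S a c'"])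
      show "\<forall>g\<in>L u. rowop S a c' (rowop S a c g) = g"
        unfolding fun_eq_iff rowop_def[of S a c' "rowop S a c g" for g] lin ac
        using a(2) by (simp add: rowop_def c'_def)
      show "\<forall>g\<in>L e. rowop S a c (rowop S a c' g) = g"
        unfolding fun_eq_iff rowop_def[of S a c "rowop S a c' g" for g] lin ac'
        using a(2) by (simp add: rowop_def c'_def)
      show "rowop S a c ` L u \<subseteq> L e"
        using units[of _ c] c0 ac a by (auto simp: L_def rowop_def c_def)
      show "rowop S a c' ` L e \<subseteq> L u"
        using units[of _ c'] c0 ac' a ae by (auto simp: L_def rowop_def c_def c'_def)
    qed
    then show ?thesis
      by (rule bij_betw_same_card)
  qed
  \<comment> \<open>Once the column at y is the unit vector, the remaining entries of row y are free
    and do not affect invertibility; they account for the power of Q with exponent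
    \<open>card D\<close>.\<close>
  define D where "D = {z\<in>S-{y}. R y z}"
  define Z where "Z = {r :: 'b \<Rightarrow> 'a. \<forall>x. x \<notin> D \<longrightarrow> r x = 0}"
  define mk where "mk = (\<lambda>(r :: 'b \<Rightarrow> 'a, g :: 'b \<Rightarrow> 'b \<Rightarrow> 'a) x z.
    if z = y then e x else if x = y then r z else g x z)"
  have Le: "card (L e) = card (Z \<times> (inc_units (S - {y}) R :: ('b \<Rightarrow> 'b \<Rightarrow> 'a) set))"
  proof -
    have "bij_betw mk (Z \<times> inc_units (S - {y}) R) (L e)"
    proof (rule bij_betw_byWitness[where
          f' = "\<lambda>g. (\<lambda>z. if z = y then 0 else g y z, \<lambda>x z. if x = y \<or> z = y then 0 else g x z)"])
      have "(if z = y then 0 else mk (r, g) y z) = r z" if "r \<in> Z" for r g z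
        using that by (auto simp: mk_def Z_def D_def)
      moreover have "(if x = y \<or> z = y then 0 else mk (r, g) x z) = g x z"
        if "g \<in> inc_units (S - {y}) R" for r x z and g :: "'b \<Rightarrow> 'b \<Rightarrow> 'a"
        using that by (auto simp: mk_def inc_units_def inc_def)
      ultimately show "\<forall>p\<in>Z \<times> inc_units (S - {y}) R. (\<lambda>z. if z = y then 0 else mk p y z,
          \<lambda>x z. if x = y \<or> z = y then 0 else mk p x z) = p"
        by (auto simp: fun_eq_iff)
      show "\<forall>g\<in>L e. mk (\<lambda>z. if z = y then 0 else g y z, \<lambda>x z. if x = y \<or> z = y then 0 else g x z) = g"
        by (auto simp: fun_eq_iff mk_def L_def)
      show "mk ` (Z \<times> inc_units (S - {y}) R) \<subseteq> L e"
      proof (clarify)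
        fix r and g :: "'b \<Rightarrow> 'b \<Rightarrow> 'a" assume r: "r \<in> Z" and g: "g \<in> inc_units (S - {y}) R"
        have "triv_ker S (mk (r, g)) \<longleftrightarrow> triv_ker (S - {y}) (mk (r, g))"
          by (rule triv_ker_unit_column) (use S in \<open>auto simp: mk_def e_def\<close>)
        also have "\<dots> \<longleftrightarrow> triv_ker (S - {y}) g"
          by (rule triv_ker_cong) (auto simp: mk_def)
        finally have "triv_ker S (mk (r, g))"
          using g by (simp add: inc_units_def)
        moreover have "mk (r, g) \<in> inc S R"
          using r g S R(1) by (auto simp: mk_def inc_def Z_def D_def e_def inc_units_def reflp_def)
        ultimately show "mk (r, g) \<in> L e"
          by (auto simp: L_def inc_units_def mk_def)
      qed
      show "(\<lambda>g. (\<lambda>z. if z = y then 0 else g y z, \<lambda>x z. if x = y \<or> z = y then 0 else g x z)) ` L e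
        \<subseteq> Z \<times> inc_units (S - {y}) R"
      proof (clarify)
        fix g assume g: "g \<in> L e"
        have "triv_ker (S - {y}) (\<lambda>x z. if x = y \<or> z = y then 0 else g x z) \<longleftrightarrow> triv_ker (S - {y}) g"
          by (rule triv_ker_cong) auto
        also have "\<dots> \<longleftrightarrow> triv_ker S g"
          by (rule triv_ker_unit_column[symmetric]) (use S g in \<open>auto simp: L_def e_def\<close>)
        finally show "(\<lambda>z. if z = y then 0 else g y z) \<in> Z
          \<and> (\<lambda>x z. if x = y \<or> z = y then 0 else g x z) \<in> inc_units (S - {y}) R"
          using g by (auto simp: L_def inc_units_def inc_def Z_def D_def)
      qed
    qed
    then show ?thesis
      by (simp add: bij_betw_same_card)
  qed
  have "card (inc_units S R :: ('b \<Rightarrow> 'b \<Rightarrow> 'a) set) = (\<Sum>u\<in>U. card (L u))"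
    unfolding union
  proof (rule card_UN_disjoint)
    show "\<forall>u\<in>U. finite (L u)"
      using finS by (simp add: L_def)
    show "\<forall>u\<in>U. \<forall>u'\<in>U. u \<noteq> u' \<longrightarrow> L u \<inter> L u' = {}"
      by (auto simp: L_def fun_eq_iff)
  qed (rule finU)
  also have "\<dots> = card U * card (L e)"
    using col by simp
  also have "card Z = CARD('a) ^ card D"
    unfolding Z_def by (rule card_zero_outside(2)) (use S in \<open>simp add: D_def\<close>)
  then have "card U * card (L e) = (CARD('a) ^ card C - 1) * CARD('a) ^ card D
      * card (inc_units (S - {y}) R :: ('b \<Rightarrow> 'b \<Rightarrow> 'a) set)"
    by (simp add: cardU Le card_cartesian_product)
  finally show ?thesis
    by (simp add: C_def D_def)
qed

text \<open>The counterpart of \<open>card_inc_units_remove\<close> for the whole algebra: the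
  admissible positions split into column y, the rest of row y, and the minor. The quotient of the
  two recursions is 1 - q^m, with m the size of column y.\<close>

lemma card_inc_remove:
  fixes S :: "'b set" and y :: 'b
  assumes S: "finite S" "y \<in> S"
  shows "card (inc S R :: ('b \<Rightarrow> 'b \<Rightarrow> 'a::{finite,zero}) set)
    = CARD('a) ^ card {x\<in>S. R x y} * CARD('a) ^ card {z\<in>S-{y}. R y z}
      * card (inc (S - {y}) R :: ('b \<Rightarrow> 'b \<Rightarrow> 'a) set)"
proof -
  let ?P = "\<lambda>S. {(x, z). x \<in> S \<and> z \<in> S \<and> R x z}"
  have fin: "finite (?P S)"
    by (rule finite_subset[of _ "S \<times> S"]) (use S in auto)
  have split: "?P S = (\<lambda>x. (x, y)) ` {x\<in>S. R x y} \<union> (\<lambda>z. (y, z)) ` {z\<in>S-{y}. R y z} \<union> ?P (S - {y})"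
    using S(2) by auto
  have "card (?P S) = card {x\<in>S. R x y} + card {z\<in>S-{y}. R y z} + card (?P (S - {y}))"
  proof -
    let ?A = "(\<lambda>x. (x, y)) ` {x\<in>S. R x y}" and ?B = "(\<lambda>z. (y, z)) ` {z\<in>S-{y}. R y z}"
    have fin': "finite (?P (S - {y}))"
      by (rule finite_subset[OF _ fin]) auto
    have "card (?P S) = card (?A \<union> ?B \<union> ?P (S - {y}))"
      using split by (rule arg_cong)
    also have "\<dots> = card (?A \<union> ?B) + card (?P (S - {y}))"
      by (rule card_Un_disjoint) (use S fin' in auto)
    also have "card (?A \<union> ?B) = card ?A + card ?B"
      by (rule card_Un_disjoint) (use S in auto)
    finally show ?thesis
      by (simp add: card_image inj_on_def)
  qed
  then show ?thesis
    using S by (simp add: card_inc(2) power_add)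
qed

text \<open>Removing an index from a minimal class of current size m contributes 1 - q^m and leaves
  m - 1 elements, so the factors of a class build up its product over r. The map \<kappa> names the
  classes; names in K of empty classes contribute empty products, which later covers vanishing
  \<open>M i j\<close>.\<close>

proposition card_inc_units:
  fixes S :: "'b set" and \<kappa> :: "'b \<Rightarrow> 'c"
  assumes "finite S" and R: "reflp R" "transp R"
    and \<kappa>: "\<And>x y. R x y \<and> R y x \<longleftrightarrow> \<kappa> x = \<kappa> y" and K: "finite K" "\<kappa> ` S \<subseteq> K"
  shows "real (card (inc_units S R :: ('b \<Rightarrow> 'b \<Rightarrow> 'a::{finite,field}) set))
    = real (card (inc S R :: ('b \<Rightarrow> 'b \<Rightarrow> 'a) set))
      * (\<Prod>c\<in>K. \<Prod>r=1..card {x\<in>S. \<kappa> x = c}. 1 - (1 / real CARD('a)) ^ r)"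
  using assms(1) K(2)
proof (induction S rule: finite_psubset_induct)
  case (psubset S)
  define q where "q = 1 / real CARD('a)"
  define \<phi> where "\<phi> m = (\<Prod>r=1..m. 1 - q ^ r)" for m :: nat
  let ?iu = "\<lambda>S. real (card (inc_units S R :: ('b \<Rightarrow> 'b \<Rightarrow> 'a) set))"
  let ?i = "\<lambda>S. real (card (inc S R :: ('b \<Rightarrow> 'b \<Rightarrow> 'a) set))"
  show ?case
  proof (cases "S = {}")
    case True
    have "inc {} R = {\<lambda>_ _. 0}"
      by (auto simp: inc_def fun_eq_iff)
    then have "inc_units {} R = {\<lambda>_ _. 0 :: 'a}" "inc {} R = {\<lambda>_ _. 0 :: 'a}"
      by (auto simp: inc_units_def triv_ker_def inc_def fun_eq_iff)
    then show ?thesis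
      by (simp add: True)
  next
    case False
    define down where "down y = {x\<in>S. R x y}" for y
    \<comment> \<open>A smallest lower set locates a minimal class: an x below y but not above it
      would have a lower set that is properly smaller, since it misses y.\<close>
    obtain y where y: "y \<in> S" "\<And>x. x \<in> S \<Longrightarrow> \<not> card (down x) < card (down y)"
      using ex_is_arg_min_if_finite[OF psubset.hyps(1) False, of "\<lambda>y. card (down y)"]
      by (auto simp: is_arg_min_def)
    have min: "R y x" if x: "x \<in> S" "R x y" for x
    proof (rule ccontr)
      assume "\<not> R y x"
      then have "down x \<subset> down y"
        using x y(1) R unfolding down_def by (auto dest: transpD reflpD)
      then have "card (down x) < card (down y)"
        by (rule psubset_card_mono[rotated]) (simp add: down_def psubset.hyps)
      then show False
        using y(2) x by blast
    qed
    define C where "C = {x\<in>S. R x y}"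
    have C: "C = {x\<in>S. \<kappa> x = \<kappa> y}"
      using min \<kappa> unfolding C_def by blast
    have cls: "card {x\<in>S-{y}. \<kappa> x = c} = (if c = \<kappa> y then card C - 1 else card {x\<in>S. \<kappa> x = c})" for c
    proof (cases "c = \<kappa> y")
      case True
      have "{x\<in>S-{y}. \<kappa> x = c} = C - {y}"
        unfolding C using True by auto
      then show ?thesis
        using True y(1) by (simp add: C)
    next
      case False
      then have "{x\<in>S-{y}. \<kappa> x = c} = {x\<in>S. \<kappa> x = c}"
        by auto
      then show ?thesis
        using False by simp
    qed
    have "card C > 0"
      using y(1) psubset.hyps unfolding C by (auto simp: card_gt_0_iff)
    then obtain m where m: "card C = Suc m"
      by (cases "card C") auto
    have \<phi>C: "\<phi> (card C) = (1 - q ^ card C) * \<phi> (card C - 1)"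
      by (simp add: m \<phi>_def)
    have K': "\<kappa> y \<in> K" "K = insert (\<kappa> y) (K - {\<kappa> y})"
      using psubset.prems y(1) by auto
    have prod: "(\<Prod>c\<in>K. \<phi> (card {x\<in>S. \<kappa> x = c}))
      = (1 - q ^ card C) * (\<Prod>c\<in>K. \<phi> (card {x\<in>S-{y}. \<kappa> x = c}))"
      unfolding cls prod.remove[OF K(1) K'(1)] by (simp add: \<phi>C C[symmetric])
    have IH: "?iu (S - {y}) = ?i (S - {y}) * (\<Prod>c\<in>K. \<phi> (card {x\<in>S-{y}. \<kappa> x = c}))"
      using psubset.IH[of "S - {y}"] y(1) psubset.prems unfolding \<phi>_def q_def by auto
    have "?iu S = (real CARD('a) ^ card C - 1) * real CARD('a) ^ card {z\<in>S-{y}. R y z} * ?iu (S - {y})"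
      using card_inc_units_remove[OF psubset.hyps(1) y(1) R min, where 'a = 'a]
      by (simp add: C_def of_nat_diff)
    also have "real CARD('a) ^ card C - 1 = real CARD('a) ^ card C * (1 - q ^ card C)"
      by (simp add: q_def field_simps)
    also have "\<dots> * real CARD('a) ^ card {z\<in>S-{y}. R y z} * ?iu (S - {y})
        = ?i S * (\<Prod>c\<in>K. \<phi> (card {x\<in>S. \<kappa> x = c}))"
      using card_inc_remove[OF psubset.hyps(1) y(1), of R, where 'a = 'a]
      by (simp add: IH prod C_def)
    finally show ?thesis
      unfolding \<phi>_def q_def .
  qed
qed

section \<open>Counting orbits and kernels\<close>

text \<open>A group action in relational form: \<open>H g U V\<close> says that \<open>g\<close> carries \<open>U\<close> to \<open>V\<close>.\<close>

locale finite_group_relation =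
  fixes G :: "'g set" and mul :: "'g \<Rightarrow> 'g \<Rightarrow> 'g" and X :: "'x set"
    and H :: "'g \<Rightarrow> 'x \<Rightarrow> 'x \<Rightarrow> bool"
  assumes finite_group: "finite G" and finite_space: "finite X"
    and act: "\<And>g V. g \<in> G \<Longrightarrow> V \<in> X \<Longrightarrow> \<exists>!V'. V' \<in> X \<and> H g V V'"
    and mul_closed: "\<And>g h. g \<in> G \<Longrightarrow> h \<in> G \<Longrightarrow> mul h g \<in> G"
    and act_mul: "\<And>g h U V W. \<lbrakk>g \<in> G; h \<in> G; U \<in> X; V \<in> X; W \<in> X; H g U V; H h V W\<rbrakk>
      \<Longrightarrow> H (mul h g) U W"
    and act_one: "\<exists>e\<in>G. \<forall>V\<in>X. H e V V"
    and act_inverse: "\<And>g. g \<in> G \<Longrightarrow> \<exists>h\<in>G. (\<forall>x\<in>G. mul h (mul g x) = x \<and> mul g (mul h x) = x)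
      \<and> (\<forall>U\<in>X. \<forall>V\<in>X. H g U V \<longrightarrow> H h V U)"
begin

definition rel :: "('x \<times> 'x) set" where
  "rel = {(U, V). U \<in> X \<and> V \<in> X \<and> (\<exists>g\<in>G. H g U V)}"

lemma equiv_rel: "equiv X rel"
proof (rule equivI)
  show "rel \<subseteq> X \<times> X"
    by (auto simp: rel_def)
  show "refl_on X rel"
    using act_one by (auto simp: refl_on_def rel_def)
  show "sym rel"
    using act_inverse by (auto simp: sym_def rel_def) blast
  show "trans rel"
    using act_mul mul_closed by (auto simp: trans_def rel_def) blast
qed

lemma rel_sym: "(U, V) \<in> rel \<Longrightarrow> (V, U) \<in> rel"
  using equiv_rel by (auto simp: equiv_def dest: symD)

lemma rel_trans: "(U, V) \<in> rel \<Longrightarrow> (V, W) \<in> rel \<Longrightarrow> (U, W) \<in> rel"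
  using equiv_rel by (auto simp: equiv_def dest: transD)

text \<open>The elements carrying U to V form the coset of the stabilizer of U through h.\<close>

lemma card_transporter:
  assumes "U \<in> X" "V \<in> X" "h \<in> G" "H h U V"
  shows "card {g\<in>G. H g U V} = card {g\<in>G. H g U U}"
proof -
  obtain h' where h': "h' \<in> G" "\<forall>x\<in>G. mul h' (mul h x) = x \<and> mul h (mul h' x) = x" "H h' V U"
    using act_inverse[OF assms(3)] assms by blast
  have "bij_betw (mul h) {g\<in>G. H g U U} {g\<in>G. H g U V}"
    by (rule bij_betw_byWitness[where f' = "mul h'"])
      (use assms h' in \<open>auto intro: mul_closed act_mul\<close>)
  then show ?thesis
    by (simp add: bij_betw_same_card)
qed

lemma orbit_stabilizer:
  assumes U: "U \<in> X"
  shows "card (rel `` {U}) * card {g\<in>G. H g U U} = card G"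
proof -
  have fin: "finite (rel `` {U})"
    by (rule finite_subset[OF _ finite_space]) (auto simp: rel_def)
  have cover: "(\<Union>V\<in>rel `` {U}. {g\<in>G. H g U V}) = G"
  proof
    show "G \<subseteq> (\<Union>V\<in>rel `` {U}. {g\<in>G. H g U V})"
    proof
      fix g assume "g \<in> G"
      with act[OF this U] U show "g \<in> (\<Union>V\<in>rel `` {U}. {g\<in>G. H g U V})"
        by (auto simp: rel_def)
    qed
  qed auto
  have "card G = card (\<Union>V\<in>rel `` {U}. {g\<in>G. H g U V})"
    unfolding cover ..
  also have "\<dots> = (\<Sum>V\<in>rel `` {U}. card {g\<in>G. H g U V})"
  proof (rule card_UN_disjoint[OF fin])
    show "\<forall>V\<in>rel `` {U}. \<forall>W\<in>rel `` {U}. V \<noteq> W \<longrightarrow> {g\<in>G. H g U V} \<inter> {g\<in>G. H g U W} = {}"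
      using act[OF _ U] unfolding rel_def by blast
  qed (use finite_group in auto)
  also have "\<dots> = (\<Sum>V\<in>rel `` {U}. card {g\<in>G. H g U U})"
    by (rule sum.cong) (auto simp: rel_def intro: card_transporter)
  finally show ?thesis
    by simp
qed

text \<open>Every point of an orbit C has a stabilizer of order |G| / |C|, so the chosen
  representative is immaterial and each summand is |C| / |G|. The use of \<open>SOME\<close> matches
  the shape of \<open>mass\<close>.\<close>

lemma sum_inverse_stabilizer:
  "(\<Sum>C\<in>X // rel. 1 / real (card {g\<in>G. H g (SOME V. V \<in> C) (SOME V. V \<in> C)}))
    = real (card X) / real (card G)"
proof -
  have "G \<noteq> {}"
    using act_one by auto
  then have G: "card G > 0"
    using finite_group by (simp add: card_gt_0_iff)
  have sub: "C \<subseteq> X" if "C \<in> X // rel" for C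
    using that by (auto simp: quotient_def rel_def)
  have inverse_card: "1 / real (card {g\<in>G. H g (SOME V. V \<in> C) (SOME V. V \<in> C)})
      = real (card C) / real (card G)" if C: "C \<in> X // rel" for C
  proof -
    define V where "V = (SOME V. V \<in> C)"
    have V: "V \<in> C"
      unfolding V_def using in_quotient_imp_non_empty[OF equiv_rel C] by (metis some_in_eq)
    then have "V \<in> X"
      using sub[OF C] by blast
    have orb: "C = rel `` {V}"
      using C
    proof (rule quotientE)
      fix U assume "C = rel `` {U}" "U \<in> X"
      then show "C = rel `` {V}"
        using V equiv_class_eq[OF equiv_rel, of U V] by auto
    qed
    have eq: "card C * card {g\<in>G. H g V V} = card G"
      unfolding orb by (rule orbit_stabilizer) fact
    then have "real (card C) * real (card {g\<in>G. H g V V}) = real (card G)"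
      by (simp only: of_nat_mult[symmetric])
    moreover from this G have "real (card {g\<in>G. H g V V}) \<noteq> 0"
      by (metis mult_zero_right of_nat_0 of_nat_eq_iff less_irrefl)
    ultimately show ?thesis
      using G unfolding V_def[symmetric] by (simp add: field_simps)
  qed
  have "card X = card (\<Union>(X // rel))"
    using Union_quotient[OF equiv_rel] by simp
  also have "\<dots> = (\<Sum>C\<in>X // rel. card C)"
  proof (rule card_Union_disjoint)
    show "pairwise disjnt (X // rel)"
      using quotient_disj[OF equiv_rel] by (auto simp: pairwise_def disjnt_def)
    show "finite C" if "C \<in> X // rel" for C
      by (rule finite_subset[OF sub[OF that] finite_space])
  qed
  finally have "real (card X) = (\<Sum>C\<in>X // rel. real (card C))"
    by simp
  then show ?thesis
    using inverse_card by (simp add: sum_divide_distrib)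
qed

end

text \<open>Translation by a multiple of \<open>w0\<close> carries the zero fibre to any other, so
  all Q fibres of a nonzero linear functional have the same size. The translation is an abstract map
  s, because W will be a set of families of matrices.\<close>

lemma card_zero_fiber:
  fixes f :: "'b \<Rightarrow> 'a::{field,finite}"
  assumes "finite W" and w0: "w0 \<in> W" "f w0 \<noteq> 0"
    and shift: "\<And>c w. w \<in> W \<Longrightarrow> s c w \<in> W \<and> f (s c w) = f w + c * f w0"
    and inv: "\<And>c w. w \<in> W \<Longrightarrow> s (- c) (s c w) = w"
  shows "CARD('a) * card {w\<in>W. f w = 0} = card W"
proof -
  have fib: "card {w\<in>W. f w = c} = card {w\<in>W. f w = 0}" for c
  proof -
    define t where "t = c / f w0"
    have t: "t * f w0 = c"
      using w0 by (simp add: t_def)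
    have "bij_betw (s t) {w\<in>W. f w = 0} {w\<in>W. f w = c}"
    proof (rule bij_betw_byWitness[where f' = "s (- t)"])
      show "\<forall>w\<in>{w\<in>W. f w = 0}. s (- t) (s t w) = w"
        using inv[of _ t] by simp
      show "\<forall>w\<in>{w\<in>W. f w = c}. s t (s (- t) w) = w"
        using inv[of _ "- t"] by simp
      show "s t ` {w\<in>W. f w = 0} \<subseteq> {w\<in>W. f w = c}"
        using shift[of _ t] t by auto
      show "s (- t) ` {w\<in>W. f w = c} \<subseteq> {w\<in>W. f w = 0}"
        using shift[of _ "- t"] t by auto
    qed
    then show ?thesis
      by (simp add: bij_betw_same_card)
  qed
  have U: "(\<Union>c. {w\<in>W. f w = c}) = W"
    by blast
  have "card W = card (\<Union>c. {w\<in>W. f w = c})"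
    unfolding U ..
  also have "\<dots> = (\<Sum>c\<in>UNIV. card {w\<in>W. f w = c})"
    by (rule card_UN_disjoint) (use assms(1) in auto)
  also have "\<dots> = (\<Sum>c\<in>(UNIV :: 'a set). card {w\<in>W. f w = 0})"
    by (rule sum.cong[OF refl fib])
  finally show ?thesis
    by simp
qed

text \<open>Counting the pairs with \<open>p u w = 0\<close> by rows and by columns replaces
  rank-nullity and the equality of row and column rank.\<close>

lemma card_kernels_of_pairing:
  fixes p :: "'u \<Rightarrow> 'w \<Rightarrow> 'a::{field,finite}"
  assumes fin: "finite U" "finite W"
    and W: "\<And>u. u \<in> U \<Longrightarrow> \<exists>w\<in>W. p u w \<noteq> 0 \<Longrightarrow> CARD('a) * card {w\<in>W. p u w = 0} = card W"
    and U: "\<And>w. w \<in> W \<Longrightarrow> \<exists>u\<in>U. p u w \<noteq> 0 \<Longrightarrow> CARD('a) * card {u\<in>U. p u w = 0} = card U"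
  shows "card {u\<in>U. \<forall>w\<in>W. p u w = 0} * card W = card {w\<in>W. \<forall>u\<in>U. p u w = 0} * card U"
proof -
  \<comment> \<open>An element of the kernel has all of W as zero set, any other one a fraction 1/Q
    of it. The statement is general in U, W and p so that it applies to the transposed pairing
    too.\<close>
  have rows: "real CARD('a) * (\<Sum>u\<in>U. real (card {w\<in>W. p u w = 0}))
      = real (card W) * (real (card U) + (real CARD('a) - 1) * real (card {u\<in>U. \<forall>w\<in>W. p u w = 0}))"
    if fin: "finite U" "finite W"
      and W: "\<And>u. u \<in> U \<Longrightarrow> \<exists>w\<in>W. p u w \<noteq> 0 \<Longrightarrow> CARD('a) * card {w\<in>W. p u w = 0} = card W"
    for U :: "'s set" and W :: "'t set" and p :: "'s \<Rightarrow> 't \<Rightarrow> 'a"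
  proof -
    let ?K = "{u\<in>U. \<forall>w\<in>W. p u w = 0}"
    have "real CARD('a) * real (card {w\<in>W. p u w = 0})
        = real (card W) * (1 + (real CARD('a) - 1) * (if u \<in> ?K then 1 else 0))"
      if u: "u \<in> U" for u
    proof (cases "u \<in> ?K")
      case True
      then have "{w\<in>W. p u w = 0} = W"
        by auto
      then show ?thesis
        using True by simp
    next
      case False
      then have "real (CARD('a) * card {w\<in>W. p u w = 0}) = real (card W)"
        using W[OF u] u by auto
      then show ?thesis
        using False by (simp only: if_False of_nat_mult mult_zero_right add_0_right mult_1_right)
    qed
    then have "real CARD('a) * (\<Sum>u\<in>U. real (card {w\<in>W. p u w = 0}))
        = (\<Sum>u\<in>U. real (card W) * (1 + (real CARD('a) - 1) * (if u \<in> ?K then 1 else 0)))"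
      unfolding sum_distrib_left by (intro sum.cong) auto
    also have "\<dots> = real (card W) * (real (card U)
        + (real CARD('a) - 1) * (\<Sum>u\<in>U. if u \<in> ?K then 1 else 0))"
      by (simp add: sum_distrib_left[symmetric] sum.distrib)
    also have "(\<Sum>u\<in>U. if u \<in> ?K then 1 else 0 :: real) = real (card ?K)"
      using fin by (simp add: sum.If_cases Int_def)
    finally show ?thesis .
  qed
  have "(\<Sum>u\<in>U. real (card {w\<in>W. p u w = 0})) = (\<Sum>u\<in>U. \<Sum>w\<in>W. if p u w = 0 then 1 else 0)"
    using fin by (simp add: sum.If_cases Int_def)
  also have "\<dots> = (\<Sum>w\<in>W. \<Sum>u\<in>U. if p u w = 0 then 1 else 0)"
    by (rule sum.swap)
  also have "\<dots> = (\<Sum>w\<in>W. real (card {u\<in>U. p u w = 0}))"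
    using fin by (simp add: sum.If_cases Int_def)
  finally have "(real CARD('a) - 1) * (real (card {u\<in>U. \<forall>w\<in>W. p u w = 0}) * real (card W))
      = (real CARD('a) - 1) * (real (card {w\<in>W. \<forall>u\<in>U. p u w = 0}) * real (card U))"
    using rows[of U W p, OF fin W] rows[of W U "\<lambda>w u. p u w", OF fin(2,1) U]
    by (simp add: algebra_simps)
  \<comment> \<open>A field has at least two elements, so the factor Q - 1 can be cancelled.\<close>
  moreover have "card {0, 1 :: 'a} \<le> CARD('a)"
    by (rule card_mono) auto
  ultimately have "real (card {u\<in>U. \<forall>w\<in>W. p u w = 0} * card W)
      = real (card {w\<in>W. \<forall>u\<in>U. p u w = 0} * card U)"
    by simp
  then show ?thesis
    by (simp only: of_nat_eq_iff)
qed

section \<open>Families of matrices and the action of the general linear groups\<close>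

text \<open>The value off I is fixed, as in the definitions of modules and group elements; equality
  of families is then equality of functions and the sets are finite over a finite field.\<close>

definition mat_fams :: "int set \<Rightarrow> (int \<Rightarrow> nat) \<Rightarrow> (int \<Rightarrow> nat) \<Rightarrow> (int \<Rightarrow> 'a::zero mat) set" where
  "mat_fams I m n = {F. (\<forall>v\<in>I. F v \<in> carrier_mat (m v) (n v)) \<and> (\<forall>v. v \<notin> I \<longrightarrow> F v = 0\<^sub>m 0 0)}"

lemma card_mat_fams:
  assumes I: "finite I"
  shows "finite (mat_fams I m n :: (int \<Rightarrow> 'a::{finite,zero} mat) set)"
    and "card (mat_fams I m n :: (int \<Rightarrow> 'a::{finite,zero} mat) set) = CARD('a) ^ (\<Sum>v\<in>I. m v * n v)"
proof -
  define P where "P = (SIGMA v:I. {..<m v} \<times> {..<n v})"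
  have fin: "finite P" and cardP: "card P = (\<Sum>v\<in>I. m v * n v)"
    using I by (simp_all add: P_def card_cartesian_product)
  let ?Z = "{f :: int \<times> nat \<times> nat \<Rightarrow> 'a. \<forall>x. x \<notin> P \<longrightarrow> f x = 0}"
  define to_fun where "to_fun = (\<lambda>(F :: int \<Rightarrow> 'a mat) (v, i, j). if (v, i, j) \<in> P then F v $$ (i, j) else 0)"
  define of_fun where "of_fun = (\<lambda>(f :: int \<times> nat \<times> nat \<Rightarrow> 'a) v.
    if v \<in> I then mat (m v) (n v) (\<lambda>(i, j). f (v, i, j)) else 0\<^sub>m 0 0)"
  have "bij_betw to_fun (mat_fams I m n) ?Z"
  proof (rule bij_betw_byWitness[where f' = of_fun])
    show "\<forall>F\<in>mat_fams I m n. of_fun (to_fun F) = F"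
    proof (intro ballI ext)
      fix F :: "int \<Rightarrow> 'a mat" and v assume "F \<in> mat_fams I m n"
      then show "of_fun (to_fun F) v = F v"
        by (cases "v \<in> I") (auto simp: mat_fams_def of_fun_def to_fun_def P_def intro!: eq_matI)
    qed
    show "\<forall>f\<in>?Z. to_fun (of_fun f) = f"
      by (auto simp: fun_eq_iff of_fun_def to_fun_def P_def)
    show "to_fun ` mat_fams I m n \<subseteq> ?Z"
      by (auto simp: to_fun_def)
    show "of_fun ` ?Z \<subseteq> mat_fams I m n"
      by (auto simp: of_fun_def mat_fams_def)
  qed
  with card_zero_outside[OF fin, where 'a = 'a] cardP
  show "finite (mat_fams I m n :: (int \<Rightarrow> 'a mat) set)"
    "card (mat_fams I m n :: (int \<Rightarrow> 'a mat) set) = CARD('a) ^ (\<Sum>v\<in>I. m v * n v)"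
    by (auto simp: bij_betw_same_card bij_betw_finite)
qed

section \<open>Inverses, products and intertwining relations in the group G\<close>

lemma invertible_mat_iff:
  assumes "A \<in> carrier_mat n n"
  shows "invertible_mat A \<longleftrightarrow> (\<exists>B\<in>carrier_mat n n. A * B = 1\<^sub>m n \<and> B * A = 1\<^sub>m n)"
proof
  assume "invertible_mat A"
  then obtain B where B: "A * B = 1\<^sub>m (dim_row A)" "B * A = 1\<^sub>m (dim_row B)"
    by (auto simp: invertible_mat_def inverts_mat_def)
  have "dim_col B = dim_row A" "dim_col A = dim_row B"
    using arg_cong[OF B(1), of dim_col] arg_cong[OF B(2), of dim_col] by auto
  then have "B \<in> carrier_mat n n"
    using assms by auto
  with B show "\<exists>B\<in>carrier_mat n n. A * B = 1\<^sub>m n \<and> B * A = 1\<^sub>m n"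
    using assms by auto
next
  assume "\<exists>B\<in>carrier_mat n n. A * B = 1\<^sub>m n \<and> B * A = 1\<^sub>m n"
  then show "invertible_mat A"
    using assms by (auto simp: invertible_mat_def inverts_mat_def square_mat.simps)
qed

lemma mult_mat_right_cancel:
  fixes P P' :: "'a::semiring_1 mat"
  assumes "P \<in> carrier_mat m n" "P' \<in> carrier_mat m n" "g \<in> carrier_mat n n" "h \<in> carrier_mat n n"
    and "g * h = 1\<^sub>m n" "P * g = P' * g"
  shows "P = P'"
proof -
  have "P * g * h = P' * g * h"
    unfolding assms(6) ..
  then show ?thesis
    using assms(1-5) by (simp add: assoc_mult_mat[of _ m n _ n _ n])
qed

text \<open>With X and Y the components of an isomorphism at the two ends of an arrow, this says
  that each summand of the preprojective relation is conjugated by the isomorphism.\<close>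

lemma intertwine_mult:
  fixes A A' B B' X Y :: "'a::semiring_0 mat"
  assumes "X \<in> carrier_mat m m" "Y \<in> carrier_mat n n"
    and "A \<in> carrier_mat m n" "A' \<in> carrier_mat m n" "B \<in> carrier_mat n m" "B' \<in> carrier_mat n m"
    and "X * A = A' * Y" "Y * B = B' * X"
  shows "X * (A * B) = A' * B' * X"
  using assoc_mult_mat[OF assms(1,3,5)] assoc_mult_mat[OF assms(4,2,5)]
    assoc_mult_mat[OF assms(4,6,1)] assms(7,8) by metis

lemma gl_famD:
  assumes "gl_fam k l d g" "v \<in> vert k l"
  shows "g v \<in> carrier_mat (d v) (d v)"
  using assms by (simp add: gl_fam_def)

lemma gl_fam_inverse:
  assumes "gl_fam k l d g"
  obtains h where "gl_fam k l d h"
    "\<And>v. v \<in> vert k l \<Longrightarrow> g v * h v = 1\<^sub>m (d v)" "\<And>v. v \<in> vert k l \<Longrightarrow> h v * g v = 1\<^sub>m (d v)"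
proof -
  have "\<exists>h. \<forall>v\<in>vert k l. h v \<in> carrier_mat (d v) (d v) \<and> g v * h v = 1\<^sub>m (d v) \<and> h v * g v = 1\<^sub>m (d v)"
  proof (intro bchoice ballI)
    fix v assume v: "v \<in> vert k l"
    then show "\<exists>h. h \<in> carrier_mat (d v) (d v) \<and> g v * h = 1\<^sub>m (d v) \<and> h * g v = 1\<^sub>m (d v)"
      using assms invertible_mat_iff[OF gl_famD[OF assms v]] by (auto simp: gl_fam_def)
  qed
  then obtain h where h: "\<And>v. v \<in> vert k l \<Longrightarrow>
      h v \<in> carrier_mat (d v) (d v) \<and> g v * h v = 1\<^sub>m (d v) \<and> h v * g v = 1\<^sub>m (d v)"
    by blast
  define h' where "h' v = (if v \<in> vert k l then h v else 0\<^sub>m 0 0)" for v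
  have "gl_fam k l d h'"
    unfolding gl_fam_def
  proof (intro conjI ballI allI impI)
    fix v assume v: "v \<in> vert k l"
    then show c: "h' v \<in> carrier_mat (d v) (d v)"
      using h by (simp add: h'_def)
    show "invertible_mat (h' v)"
      unfolding invertible_mat_iff[OF c] using v h gl_famD[OF assms v] by (auto simp: h'_def)
  qed (simp add: h'_def)
  then show thesis
    by (rule that) (simp_all add: h'_def h)
qed

lemma gl_fam_mult:
  assumes "gl_fam k l d g" "gl_fam k l d h"
  shows "gl_fam k l d (\<lambda>v. h v * g v)"
  unfolding gl_fam_def
proof (intro conjI ballI allI impI)
  fix v assume v: "v \<in> vert k l"
  note c = gl_famD[OF assms(1) v] gl_famD[OF assms(2) v]
  then show hg: "h v * g v \<in> carrier_mat (d v) (d v)"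
    by simp
  obtain g' where g': "g' \<in> carrier_mat (d v) (d v)" "g v * g' = 1\<^sub>m (d v)" "g' * g v = 1\<^sub>m (d v)"
    using assms(1) v invertible_mat_iff[OF c(1)] by (auto simp: gl_fam_def)
  obtain h' where h': "h' \<in> carrier_mat (d v) (d v)" "h v * h' = 1\<^sub>m (d v)" "h' * h v = 1\<^sub>m (d v)"
    using assms(2) v invertible_mat_iff[OF c(2)] by (auto simp: gl_fam_def)
  have "h v * g v * (g' * h') = h v * (g v * g' * h')" "g' * h' * (h v * g v) = g' * (h' * h v * g v)"
    using c g'(1) h'(1) by (simp_all add: assoc_mult_mat[of _ "d v" "d v" _ "d v" _ "d v"])
  then show "invertible_mat (h v * g v)"
    unfolding invertible_mat_iff[OF hg] using c g' h' by (intro bexI[of _ "g' * h'"]) simp_all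
next
  fix v assume "v \<notin> vert k l"
  then show "h v * g v = 0\<^sub>m 0 0"
    using assms by (simp add: gl_fam_def)
qed

lemma finite_vert: "finite (vert k l)" and finite_arrs: "finite (arrs k l)"
  by (simp_all add: vert_def arrs_def)

lemma arrs_vert: "w \<in> arrs k l \<Longrightarrow> w \<in> vert k l"
  by (simp add: arrs_def)

lemma tgt_vert: "w \<in> arrs k l \<Longrightarrow> 1 \<le> k \<Longrightarrow> 1 \<le> l \<Longrightarrow> tgt w \<in> vert k l"
  by (auto simp: arrs_def vert_def tgt_def)

lemma gl_fam_one: "gl_fam k l d (\<lambda>v. if v \<in> vert k l then 1\<^sub>m (d v) else 0\<^sub>m 0 0 :: 'a::field mat)"
proof -
  have "invertible_mat (1\<^sub>m n :: 'a mat)" for n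
    by (subst invertible_mat_iff[of _ n]) auto
  then show ?thesis
    by (simp add: gl_fam_def)
qed

lemma gl_fam_subset: "{g. gl_fam k l d g} \<subseteq> mat_fams (vert k l) d d"
  by (auto simp: gl_fam_def mat_fams_def)

lemma gl_fam_cancel:
  assumes "gl_fam k l d x" "gl_fam k l d g" "gl_fam k l d h"
    and "\<And>v. v \<in> vert k l \<Longrightarrow> h v * g v = 1\<^sub>m (d v)"
  shows "(\<lambda>v. h v * (g v * x v)) = x"
proof
  fix v
  show "h v * (g v * x v) = x v"
  proof (cases "v \<in> vert k l")
    case True
    note c = gl_famD[OF assms(1) True] gl_famD[OF assms(2) True] gl_famD[OF assms(3) True]
    then have "h v * (g v * x v) = h v * g v * x v"
      by (simp add: assoc_mult_mat[of _ "d v" "d v" _ "d v" _ "d v"])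
    then show ?thesis
      using assms(4)[OF True] c by simp
  next
    case False
    then show ?thesis
      using assms by (simp add: gl_fam_def)
  qed
qed

lemma is_qrep_iff: "is_qrep k l d A \<longleftrightarrow> A \<in> mat_fams (arrs k l) (\<lambda>w. d (tgt w)) d"
  by (auto simp: is_qrep_def mat_fams_def)

lemma is_pimod_iff: "is_pimod k l d V \<longleftrightarrow> is_qrep k l d (fst V)
    \<and> snd V \<in> mat_fams (arrs k l) d (\<lambda>w. d (tgt w))
    \<and> (\<forall>v\<in>vert k l. out_term k l d V v = in_term k l d V v)"
  by (auto simp: is_pimod_def mat_fams_def)

lemma intertwine_trans:
  fixes A A' A'' g g' h h' :: "'a::semiring_0 mat"
  assumes "g \<in> carrier_mat m m" "h \<in> carrier_mat m m" "g' \<in> carrier_mat n n" "h' \<in> carrier_mat n n"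
    and "A \<in> carrier_mat m n" "A' \<in> carrier_mat m n" "A'' \<in> carrier_mat m n"
    and "g * A = A' * g'" "h * A' = A'' * h'"
  shows "h * g * A = A'' * (h' * g')"
  using assoc_mult_mat[OF assms(2,1,5)] assoc_mult_mat[OF assms(2,6,3)]
    assoc_mult_mat[OF assms(7,4,3)] assms(8,9) by metis

lemma intertwine_inverse:
  fixes A A' g g' h h' :: "'a::semiring_1 mat"
  assumes "g \<in> carrier_mat m m" "h \<in> carrier_mat m m" "g' \<in> carrier_mat n n" "h' \<in> carrier_mat n n"
    and "A \<in> carrier_mat m n" "A' \<in> carrier_mat m n"
    and "h * g = 1\<^sub>m m" "g' * h' = 1\<^sub>m n" "g * A = A' * g'"
  shows "h * A' = A * h'"
proof -
  have "h * A' = h * (A' * (g' * h'))"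
    using assms by simp
  also have "\<dots> = h * (g * (A * h'))"
    using assoc_mult_mat[OF assms(6,3,4)] assoc_mult_mat[OF assms(1,5,4)] assms(9) by simp
  also have "\<dots> = h * g * (A * h')"
    by (rule assoc_mult_mat[symmetric]) (use assms in auto)
  also have "\<dots> = A * h'"
    unfolding assms(7) by (rule left_mult_one_mat) (use assms in auto)
  finally show ?thesis .
qed

lemma ex1_conjugate:
  fixes A g g' h' :: "'a::semiring_1 mat"
  assumes "g \<in> carrier_mat m m" "g' \<in> carrier_mat n n" "h' \<in> carrier_mat n n"
    and "A \<in> carrier_mat m n" and "g' * h' = 1\<^sub>m n" "h' * g' = 1\<^sub>m n"
  shows "\<exists>!A'. A' \<in> carrier_mat m n \<and> g * A = A' * g'"
proof (rule ex1I[of _ "g * A * h'"])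
  have "g * A * h' * g' = g * A * (h' * g')"
    by (rule assoc_mult_mat) (use assms in auto)
  also have "\<dots> = g * A"
    unfolding assms(6) by (rule right_mult_one_mat) (use assms in auto)
  finally show "g * A * h' \<in> carrier_mat m n \<and> g * A = g * A * h' * g'"
    using assms by simp
next
  fix A' assume A': "A' \<in> carrier_mat m n \<and> g * A = A' * g'"
  have "A' * g' * h' = A' * (g' * h')"
    by (rule assoc_mult_mat) (use assms A' in auto)
  also have "\<dots> = A'"
    unfolding assms(5) by (rule right_mult_one_mat) (use A' in auto)
  finally show "A' = g * A * h'"
    using A' by simp
qed

text \<open>Unique choice at each index of I; uniqueness of the whole family follows because members
  of \<open>mat_fams\<close> agree off I.\<close>

lemma ex1_mat_fams:
  assumes "\<And>v. v \<in> I \<Longrightarrow> \<exists>!X. X \<in> carrier_mat (m v) (n v) \<and> P v X"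
  shows "\<exists>!F. F \<in> mat_fams I m n \<and> (\<forall>v\<in>I. P v (F v))"
proof -
  have "\<exists>F. \<forall>v\<in>I. F v \<in> carrier_mat (m v) (n v) \<and> P v (F v)"
    using assms by (intro bchoice) blast
  then obtain F where F: "\<And>v. v \<in> I \<Longrightarrow> F v \<in> carrier_mat (m v) (n v) \<and> P v (F v)"
    by blast
  show ?thesis
  proof (rule ex1I[of _ "\<lambda>v. if v \<in> I then F v else 0\<^sub>m 0 0"])
    show "(\<lambda>v. if v \<in> I then F v else 0\<^sub>m 0 0) \<in> mat_fams I m n
        \<and> (\<forall>v\<in>I. P v (if v \<in> I then F v else 0\<^sub>m 0 0))"
      using F by (simp add: mat_fams_def)
    fix F' assume F': "F' \<in> mat_fams I m n \<and> (\<forall>v\<in>I. P v (F' v))"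
    show "F' = (\<lambda>v. if v \<in> I then F v else 0\<^sub>m 0 0)"
    proof
      fix v
      show "F' v = (if v \<in> I then F v else 0\<^sub>m 0 0)"
        using F' F assms[of v] by (cases "v \<in> I") (auto simp: mat_fams_def)
    qed
  qed
qed

section \<open>Representations, endomorphism families and reverse maps in coordinates\<close>

locale quiver_dims =
  fixes k l :: nat and d :: "int \<Rightarrow> nat"
  assumes kl: "1 \<le> k" "1 \<le> l"
begin

text \<open>\<open>endos\<close> is the full product of matrix algebras containing G, and
  \<open>coreps\<close>, the space of the reverse maps, is dual to \<open>reps\<close> under the
  trace.\<close>

abbreviation "reps \<equiv> mat_fams (arrs k l) (\<lambda>w. d (tgt w)) d"
abbreviation "endos \<equiv> mat_fams (vert k l) d d"
abbreviation "coreps \<equiv> mat_fams (arrs k l) d (\<lambda>w. d (tgt w))"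

lemmas tgt_vert' = tgt_vert[OF _ kl]

lemma endosD: "g \<in> endos \<Longrightarrow> v \<in> vert k l \<Longrightarrow> g v \<in> carrier_mat (d v) (d v)"
  by (simp add: mat_fams_def)

lemma gl_endos: "gl_fam k l d g \<Longrightarrow> g \<in> endos"
  using gl_fam_subset by blast

lemma repsD: "A \<in> reps \<Longrightarrow> w \<in> arrs k l \<Longrightarrow> A w \<in> carrier_mat (d (tgt w)) (d w)"
  and corepsD: "B \<in> coreps \<Longrightarrow> w \<in> arrs k l \<Longrightarrow> B w \<in> carrier_mat (d w) (d (tgt w))"
  by (simp_all add: mat_fams_def)

lemma ex1_qhom:
  fixes A :: "'a::field qrep"
  assumes g: "gl_fam k l d g" and A: "A \<in> reps"
  shows "\<exists>!A'. A' \<in> reps \<and> qhom_by k l g A A'"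
  unfolding qhom_by_def
proof (rule ex1_mat_fams)
  fix w assume w: "w \<in> arrs k l"
  obtain h where "gl_fam k l d h"
    "\<And>v. v \<in> vert k l \<Longrightarrow> g v * h v = 1\<^sub>m (d v)" "\<And>v. v \<in> vert k l \<Longrightarrow> h v * g v = 1\<^sub>m (d v)"
    using gl_fam_inverse[OF g] by metis
  then show "\<exists>!X. X \<in> carrier_mat (d (tgt w)) (d w) \<and> g (tgt w) * A w = X * g w"
    using w by (intro ex1_conjugate[of _ _ _ _ "h w"] gl_famD[OF g] gl_famD[of k l d h] repsD[OF A] tgt_vert') (auto dest: arrs_vert)
qed

lemma ex1_cohom:
  fixes B :: "int \<Rightarrow> 'a::field mat"
  assumes g: "gl_fam k l d g" and B: "B \<in> coreps"
  shows "\<exists>!B'. B' \<in> coreps \<and> (\<forall>w\<in>arrs k l. g w * B w = B' w * g (tgt w))"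
proof (rule ex1_mat_fams)
  fix w assume w: "w \<in> arrs k l"
  obtain h where "gl_fam k l d h"
    "\<And>v. v \<in> vert k l \<Longrightarrow> g v * h v = 1\<^sub>m (d v)" "\<And>v. v \<in> vert k l \<Longrightarrow> h v * g v = 1\<^sub>m (d v)"
    using gl_fam_inverse[OF g] by metis
  then show "\<exists>!X. X \<in> carrier_mat (d w) (d (tgt w)) \<and> g w * B w = X * g (tgt w)"
    using w by (intro ex1_conjugate[of _ _ _ _ "h (tgt w)"] gl_famD[OF g] gl_famD[of k l d h] corepsD[OF B] tgt_vert') (auto dest: arrs_vert tgt_vert')
qed

lemma qhom_trans:
  fixes A :: "'a::field qrep"
  assumes "g \<in> endos" "h \<in> endos" "A \<in> reps" "A' \<in> reps" "A'' \<in> reps"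
    and "qhom_by k l g A A'" "qhom_by k l h A' A''"
  shows "qhom_by k l (\<lambda>v. h v * g v) A A''"
  unfolding qhom_by_def
proof
  fix w assume w: "w \<in> arrs k l"
  show "h (tgt w) * g (tgt w) * A w = A'' w * (h w * g w)"
    by (rule intertwine_trans[of _ "d (tgt w)" _ _ "d w" _ _ "A' w"])
      (use assms w in \<open>auto intro: endosD repsD tgt_vert' arrs_vert simp: qhom_by_def\<close>)
qed

lemma cohom_trans:
  fixes B :: "int \<Rightarrow> 'a::field mat"
  assumes "gl_fam k l d g" "gl_fam k l d h" "B \<in> coreps" "B' \<in> coreps" "B'' \<in> coreps"
    and "w \<in> arrs k l" "g w * B w = B' w * g (tgt w)" "h w * B' w = B'' w * h (tgt w)"
  shows "h w * g w * B w = B'' w * (h (tgt w) * g (tgt w))"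
  by (rule intertwine_trans[of _ "d w" _ _ "d (tgt w)" _ _ "B' w"])
    (use assms in \<open>auto intro: gl_famD corepsD tgt_vert' arrs_vert\<close>)

lemma qhom_inverse:
  fixes A :: "'a::field qrep"
  assumes "gl_fam k l d g" "gl_fam k l d h" "A \<in> reps" "A' \<in> reps"
    and "\<And>v. v \<in> vert k l \<Longrightarrow> g v * h v = 1\<^sub>m (d v)" "\<And>v. v \<in> vert k l \<Longrightarrow> h v * g v = 1\<^sub>m (d v)"
    and "qhom_by k l g A A'"
  shows "qhom_by k l h A' A"
  unfolding qhom_by_def
proof
  fix w assume w: "w \<in> arrs k l"
  show "h (tgt w) * A' w = A w * h w"
    by (rule intertwine_inverse[of "g (tgt w)" "d (tgt w)" _ "g w" "d w"])
      (use assms w in \<open>auto intro: gl_famD repsD tgt_vert' arrs_vert simp: qhom_by_def\<close>)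
qed

lemma cohom_inverse:
  fixes B :: "int \<Rightarrow> 'a::field mat"
  assumes "gl_fam k l d g" "gl_fam k l d h" "B \<in> coreps" "B' \<in> coreps"
    and "\<And>v. v \<in> vert k l \<Longrightarrow> g v * h v = 1\<^sub>m (d v)" "\<And>v. v \<in> vert k l \<Longrightarrow> h v * g v = 1\<^sub>m (d v)"
    and "w \<in> arrs k l" "g w * B w = B' w * g (tgt w)"
  shows "h w * B' w = B w * h (tgt w)"
  by (rule intertwine_inverse[of "g w" "d w" _ "g (tgt w)" "d (tgt w)"])
    (use assms in \<open>auto intro: gl_famD corepsD tgt_vert' arrs_vert\<close>)

lemma qhom_one:
  fixes A :: "'a::field qrep"
  assumes "A \<in> reps"
  shows "qhom_by k l (\<lambda>v. if v \<in> vert k l then 1\<^sub>m (d v) else 0\<^sub>m 0 0) A A"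
  using assms tgt_vert' by (auto simp: qhom_by_def arrs_vert dest: repsD)

text \<open>The action on representations of the quiver alone. Its orbits are the isomorphism
  classes, and the stabilizer of A is the automorphism group of A.\<close>

sublocale qreps: finite_group_relation "{g :: int \<Rightarrow> 'a::{field,finite} mat. gl_fam k l d g}"
  "\<lambda>h g v. h v * g v" reps "qhom_by k l"
proof
  show "finite {g :: int \<Rightarrow> 'a mat. gl_fam k l d g}"
    by (rule finite_subset[OF gl_fam_subset]) (rule card_mat_fams(1)[OF finite_vert])
  show "finite (reps :: 'a qrep set)"
    by (rule card_mat_fams(1)[OF finite_arrs])
  show "\<exists>e\<in>{g :: int \<Rightarrow> 'a mat. gl_fam k l d g}. \<forall>A\<in>reps. qhom_by k l e A A"
    using gl_fam_one qhom_one by blast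
  fix g :: "int \<Rightarrow> 'a mat" assume "g \<in> {g. gl_fam k l d g}"
  then have g: "gl_fam k l d g"
    by simp
  show "\<exists>!A'. A' \<in> reps \<and> qhom_by k l g A A'" if "A \<in> reps" for A
    by (rule ex1_qhom[OF g that])
  obtain h where h: "gl_fam k l d h"
    "\<And>v. v \<in> vert k l \<Longrightarrow> g v * h v = 1\<^sub>m (d v)" "\<And>v. v \<in> vert k l \<Longrightarrow> h v * g v = 1\<^sub>m (d v)"
    using gl_fam_inverse[OF g] by metis
  show "\<exists>h\<in>{g. gl_fam k l d g}. (\<forall>x\<in>{g. gl_fam k l d g}.
      (\<lambda>v. h v * (g v * x v)) = x \<and> (\<lambda>v. g v * (h v * x v)) = x)
      \<and> (\<forall>U\<in>reps. \<forall>V\<in>reps. qhom_by k l g U V \<longrightarrow> qhom_by k l h V U)"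
    using h gl_fam_cancel[OF _ g h(1,3)] gl_fam_cancel[OF _ h(1) g h(2)] qhom_inverse[OF g h(1) _ _ h(2,3)]
    by (intro bexI[of _ h]) auto
qed (auto intro: gl_fam_mult qhom_trans gl_endos)

end

section \<open>The trace pairing\<close>

definition mtrace :: "'a::comm_ring_1 mat \<Rightarrow> 'a" where
  "mtrace X = (\<Sum>i<dim_row X. X $$ (i, i))"

lemma mtrace_mult:
  assumes "A \<in> carrier_mat m n" "B \<in> carrier_mat n m"
  shows "mtrace (A * B) = (\<Sum>i<m. \<Sum>j<n. A $$ (i, j) * B $$ (j, i))"
  using assms by (simp add: mtrace_def scalar_prod_def lessThan_atLeast0)

lemma mtrace_commute:
  assumes "A \<in> carrier_mat m n" "B \<in> carrier_mat n m"
  shows "mtrace (A * B) = mtrace (B * A)"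
  unfolding mtrace_mult[OF assms] mtrace_mult[OF assms(2,1)]
  by (subst sum.swap) (simp add: mult.commute)

lemma mtrace_add: "X \<in> carrier_mat n n \<Longrightarrow> Y \<in> carrier_mat n n \<Longrightarrow> mtrace (X + Y) = mtrace X + mtrace Y"
  and mtrace_minus: "X \<in> carrier_mat n n \<Longrightarrow> Y \<in> carrier_mat n n \<Longrightarrow> mtrace (X - Y) = mtrace X - mtrace Y"
  and mtrace_zero: "mtrace (0\<^sub>m n n) = 0"
  by (simp_all add: mtrace_def sum.distrib sum_subtractf sum_distrib_left)

lemma mtrace_mult_zero: "X \<in> carrier_mat m n \<Longrightarrow> mtrace (X * 0\<^sub>m n m) = 0"
  by (simp add: mtrace_zero)

text \<open>Pairing with the matrix unit at position (j0, i0) reads off the entry of X at (i0,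
  j0).\<close>

lemma mtrace_nondegenerate:
  assumes X: "X \<in> carrier_mat m n"
    and zero: "\<And>Y. Y \<in> carrier_mat n m \<Longrightarrow> mtrace (X * Y) = 0"
  shows "X = 0\<^sub>m m n"
proof (rule eq_matI)
  fix i0 j0 assume ij: "i0 < dim_row (0\<^sub>m m n)" "j0 < dim_col (0\<^sub>m m n)"
  define Y :: "'a mat" where "Y = mat n m (\<lambda>(j, i). if j = j0 \<and> i = i0 then 1 else 0)"
  have Y: "Y \<in> carrier_mat n m"
    by (simp add: Y_def)
  have "mtrace (X * Y) = (\<Sum>i<m. \<Sum>j<n. if j = j0 then (if i = i0 then X $$ (i, j) else 0) else 0)"
    unfolding mtrace_mult[OF X Y] by (intro sum.cong) (auto simp: Y_def)
  also have "\<dots> = X $$ (i0, j0)"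
    using ij by simp
  finally show "X $$ (i0, j0) = 0\<^sub>m m n $$ (i0, j0)"
    using zero[OF Y] ij by simp
qed (use X in auto)

lemma eq_minus_zero_mat:
  fixes X Y :: "'a::ring mat"
  assumes "X \<in> carrier_mat m n" "Y \<in> carrier_mat m n"
  shows "X - Y = 0\<^sub>m m n \<longleftrightarrow> X = Y"
proof
  assume eq: "X - Y = 0\<^sub>m m n"
  show "X = Y"
  proof (rule eq_matI)
    fix i j assume "i < dim_row Y" "j < dim_col Y"
    then show "X $$ (i, j) = Y $$ (i, j)"
      using arg_cong[OF eq, of "\<lambda>M. M $$ (i, j)"] assms by simp
  qed (use assms in auto)
qed (use assms in auto)

text \<open>Linearity in the translated form that \<open>card_zero_fiber\<close> asks for;
  \<open>mat_fams_shift\<close> provides the translations themselves.\<close>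

lemma mtrace_mult_shift:
  assumes "X \<in> carrier_mat m n" "Y \<in> carrier_mat n m" "Z \<in> carrier_mat n m"
  shows "mtrace (X * (Y + c \<cdot>\<^sub>m Z)) = mtrace (X * Y) + c * mtrace (X * Z)"
  unfolding mtrace_mult[OF assms(1,2)] mtrace_mult[OF assms(1,3)]
    mtrace_mult[OF assms(1) add_carrier_mat[OF smult_carrier_mat[OF assms(3)]]]
  using assms by (simp add: algebra_simps sum.distrib sum_distrib_left)

lemma mat_fams_shift:
  fixes F F0 :: "int \<Rightarrow> 'a::comm_ring_1 mat"
  assumes "F \<in> mat_fams I m n" "F0 \<in> mat_fams I m n"
  shows "(\<lambda>v. F v + c \<cdot>\<^sub>m F0 v) \<in> mat_fams I m n"
    and "(\<lambda>v. (F v + c \<cdot>\<^sub>m F0 v) + (- c) \<cdot>\<^sub>m F0 v) = F"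
proof -
  show 1: "(\<lambda>v. F v + c \<cdot>\<^sub>m F0 v) \<in> mat_fams I m n"
    using assms by (auto simp: mat_fams_def)
  show "(\<lambda>v. (F v + c \<cdot>\<^sub>m F0 v) + (- c) \<cdot>\<^sub>m F0 v) = F"
  proof
    fix v
    obtain a b where "F v \<in> carrier_mat a b" "F0 v \<in> carrier_mat a b"
      using assms unfolding mat_fams_def by (cases "v \<in> I") auto
    then show "(F v + c \<cdot>\<^sub>m F0 v) + (- c) \<cdot>\<^sub>m F0 v = F v"
      by (auto intro!: eq_matI)
  qed
qed

context quiver_dims
begin

text \<open>Under this pairing the moment map \<open>B \<mapsto> (moment A B v)\<^sub>v\<close>, whose kernel is the set of module
  structures over \<open>A\<close>, is the transpose of \<open>g \<mapsto> (g (tgt w) A w - A w g w)\<^sub>w\<close>, whose kernel is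
  the endomorphism ring of \<open>A\<close>.\<close>

definition pairing :: "'a::field qrep \<Rightarrow> (int \<Rightarrow> 'a mat) \<Rightarrow> (int \<Rightarrow> 'a mat) \<Rightarrow> 'a" where
  "pairing A g B = (\<Sum>w\<in>arrs k l. mtrace ((g (tgt w) * A w - A w * g w) * B w))"

abbreviation "moment A B v \<equiv> in_term k l d (A, B) v - out_term k l d (A, B) v"

lemma out_term_carrier:
  assumes "A \<in> reps" "B \<in> coreps"
  shows "out_term k l d (A, B) v \<in> carrier_mat (d v) (d v)"
  using assms by (auto simp: out_term_def intro!: mult_carrier_mat dest: repsD corepsD)

lemma in_term_carrier:
  assumes "A \<in> reps" "B \<in> coreps"
  shows "in_term k l d (A, B) v \<in> carrier_mat (d v) (d v)"
  using repsD[OF assms(1), of "v + 1"] repsD[OF assms(1), of "v - 1"]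
    corepsD[OF assms(2), of "v + 1"] corepsD[OF assms(2), of "v - 1"]
  by (auto simp: in_term_def intro!: mult_carrier_mat add_carrier_mat)

text \<open>A positive arrow w ends at w - 1 and a negative one at w + 1, so each arrow is met at
  exactly one vertex. Both conditionals can hold only at vertex 0, where the two branches
  meet.\<close>

lemma sum_arrs_by_target:
  fixes F :: "int \<Rightarrow> 'b::comm_monoid_add"
  shows "(\<Sum>v\<in>vert k l. (if v + 1 \<in> arrs k l \<and> tgt (v + 1) = v then F (v + 1) else 0)
      + (if v - 1 \<in> arrs k l \<and> tgt (v - 1) = v then F (v - 1) else 0)) = (\<Sum>w\<in>arrs k l. F w)"
proof -
  have "(\<Sum>v\<in>vert k l. if v + 1 \<in> arrs k l \<and> tgt (v + 1) = v then F (v + 1) else 0)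
      = (\<Sum>v\<in>{v\<in>vert k l. v + 1 \<in> arrs k l \<and> tgt (v + 1) = v}. F (v + 1))"
    by (rule sum.inter_filter[symmetric]) (rule finite_vert)
  also have "\<dots> = (\<Sum>w\<in>{w\<in>arrs k l. w > 0}. F w)"
    by (rule sum.reindex_bij_witness[of _ "\<lambda>w. w - 1" "\<lambda>v. v + 1"])
      (use kl in \<open>auto simp: arrs_def vert_def tgt_def split: if_splits\<close>)
  finally have 1: "(\<Sum>v\<in>vert k l. if v + 1 \<in> arrs k l \<and> tgt (v + 1) = v then F (v + 1) else 0)
      = (\<Sum>w\<in>{w\<in>arrs k l. w > 0}. F w)" .
  have "(\<Sum>v\<in>vert k l. if v - 1 \<in> arrs k l \<and> tgt (v - 1) = v then F (v - 1) else 0)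
      = (\<Sum>v\<in>{v\<in>vert k l. v - 1 \<in> arrs k l \<and> tgt (v - 1) = v}. F (v - 1))"
    by (rule sum.inter_filter[symmetric]) (rule finite_vert)
  also have "\<dots> = (\<Sum>w\<in>{w\<in>arrs k l. \<not> w > 0}. F w)"
    by (rule sum.reindex_bij_witness[of _ "\<lambda>w. w + 1" "\<lambda>v. v - 1"])
      (use kl in \<open>auto simp: arrs_def vert_def tgt_def split: if_splits\<close>)
  finally have 2: "(\<Sum>v\<in>vert k l. if v - 1 \<in> arrs k l \<and> tgt (v - 1) = v then F (v - 1) else 0)
      = (\<Sum>w\<in>{w\<in>arrs k l. \<not> w > 0}. F w)" .
  have "(\<Sum>w\<in>arrs k l. F w) = (\<Sum>w\<in>{w\<in>arrs k l. w > 0} \<union> {w\<in>arrs k l. \<not> w > 0}. F w)"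
    by (rule arg_cong[of _ _ "sum F"]) auto
  also have "\<dots> = (\<Sum>w\<in>{w\<in>arrs k l. w > 0}. F w) + (\<Sum>w\<in>{w\<in>arrs k l. \<not> w > 0}. F w)"
    by (rule sum.union_disjoint) (auto simp: finite_arrs)
  finally show ?thesis
    by (simp add: sum.distrib 1 2)
qed

lemma sum_arrs_by_source:
  fixes F :: "int \<Rightarrow> 'b::comm_monoid_add"
  shows "(\<Sum>v\<in>vert k l. if v \<in> arrs k l then F v else 0) = (\<Sum>w\<in>arrs k l. F w)"
proof -
  have "arrs k l = vert k l \<inter> arrs k l"
    by (auto simp: arrs_def)
  then show ?thesis
    by (simp add: sum.inter_restrict[OF finite_vert, symmetric])
qed

text \<open>Cyclicity of the trace turns tr(A g B) into tr(g B A). The terms with A B are then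
  collected at the target of their arrow and the terms with B A at its source, which are the two
  sides of the preprojective relation.\<close>

lemma pairing_eq_moment:
  fixes A :: "'a::field qrep"
  assumes A: "A \<in> reps" and B: "B \<in> coreps" and g: "g \<in> endos"
  shows "pairing A g B = (\<Sum>v\<in>vert k l. mtrace (g v * moment A B v))"
proof -
  have arr: "mtrace ((g (tgt w) * A w - A w * g w) * B w)
      = mtrace (g (tgt w) * (A w * B w)) - mtrace (g w * (B w * A w))" if w: "w \<in> arrs k l" for w
  proof -
    let ?s = "d w" and ?t = "d (tgt w)"
    have c: "A w \<in> carrier_mat ?t ?s" "B w \<in> carrier_mat ?s ?t"
        "g w \<in> carrier_mat ?s ?s" "g (tgt w) \<in> carrier_mat ?t ?t"
      using A B g w by (auto intro: repsD corepsD endosD arrs_vert tgt_vert')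
    have "(g (tgt w) * A w - A w * g w) * B w = g (tgt w) * A w * B w - A w * g w * B w"
      by (rule minus_mult_distrib_mat) (use c in auto)
    also have "\<dots> = g (tgt w) * (A w * B w) - A w * (g w * B w)"
      using c by (simp add: assoc_mult_mat[of _ ?t ?t _ ?s _ ?t] assoc_mult_mat[of _ ?t ?s _ ?s _ ?t])
    also have "mtrace \<dots> = mtrace (g (tgt w) * (A w * B w)) - mtrace (A w * (g w * B w))"
      by (rule mtrace_minus) (use c in auto)
    also have "mtrace (A w * (g w * B w)) = mtrace (g w * B w * A w)"
      by (rule mtrace_commute) (use c in auto)
    also have "g w * B w * A w = g w * (B w * A w)"
      by (rule assoc_mult_mat) (use c in auto)
    finally show ?thesis .
  qed
  have "mtrace (g v * moment A B v)
      = ((if v + 1 \<in> arrs k l \<and> tgt (v + 1) = v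
            then mtrace (g (tgt (v + 1)) * (A (v + 1) * B (v + 1))) else 0)
        + (if v - 1 \<in> arrs k l \<and> tgt (v - 1) = v
            then mtrace (g (tgt (v - 1)) * (A (v - 1) * B (v - 1))) else 0))
      - (if v \<in> arrs k l then mtrace (g v * (B v * A v)) else 0)" if v: "v \<in> vert k l" for v
  proof -
    let ?X = "if v + 1 \<in> arrs k l \<and> tgt (v + 1) = v then A (v + 1) * B (v + 1) else 0\<^sub>m (d v) (d v)"
    let ?Y = "if v - 1 \<in> arrs k l \<and> tgt (v - 1) = v then A (v - 1) * B (v - 1) else 0\<^sub>m (d v) (d v)"
    have gv: "g v \<in> carrier_mat (d v) (d v)"
      using g v by (rule endosD)
    have c: "?X \<in> carrier_mat (d v) (d v)" "?Y \<in> carrier_mat (d v) (d v)"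
      using repsD[OF A, of "v + 1"] repsD[OF A, of "v - 1"] corepsD[OF B, of "v + 1"] corepsD[OF B, of "v - 1"]
      by (auto intro!: mult_carrier_mat)
    have "mtrace (g v * moment A B v) = mtrace (g v * in_term k l d (A, B) v) - mtrace (g v * out_term k l d (A, B) v)"
      using gv in_term_carrier[OF A B, of v] out_term_carrier[OF A B, of v]
      by (simp add: mult_minus_distrib_mat[of _ "d v" "d v" _ "d v"] mtrace_minus[of _ "d v"])
    also have "mtrace (g v * in_term k l d (A, B) v) = mtrace (g v * ?X) + mtrace (g v * ?Y)"
      using gv c unfolding in_term_def fst_conv snd_conv
      by (subst mult_add_distrib_mat[of _ "d v" "d v" _ "d v"]) (auto simp: mtrace_add[of _ "d v"])
    also have "mtrace (g v * ?X) = (if v + 1 \<in> arrs k l \<and> tgt (v + 1) = v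
            then mtrace (g (tgt (v + 1)) * (A (v + 1) * B (v + 1))) else 0)"
      using gv by (simp add: mtrace_zero)
    also have "mtrace (g v * ?Y) = (if v - 1 \<in> arrs k l \<and> tgt (v - 1) = v
            then mtrace (g (tgt (v - 1)) * (A (v - 1) * B (v - 1))) else 0)"
      using gv by (simp add: mtrace_zero)
    also have "mtrace (g v * out_term k l d (A, B) v) = (if v \<in> arrs k l then mtrace (g v * (B v * A v)) else 0)"
      using gv by (simp add: out_term_def mtrace_zero)
    finally show ?thesis .
  qed
  then have "(\<Sum>v\<in>vert k l. mtrace (g v * moment A B v))
      = (\<Sum>w\<in>arrs k l. mtrace (g (tgt w) * (A w * B w))) - (\<Sum>w\<in>arrs k l. mtrace (g w * (B w * A w)))"
    by (simp only: sum_subtractf sum_arrs_by_target[of "\<lambda>w. mtrace (g (tgt w) * (A w * B w))"]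
        sum_arrs_by_source cong: sum.cong)
  also have "\<dots> = pairing A g B"
    by (simp add: pairing_def arr sum_subtractf)
  finally show ?thesis ..
qed

lemma arr_carrier:
  assumes "A \<in> reps" "g \<in> endos" "w \<in> arrs k l"
  shows "g (tgt w) * A w - A w * g w \<in> carrier_mat (d (tgt w)) (d w)"
  using assms by (intro minus_carrier_mat mult_carrier_mat[of _ _ "d w"])
    (auto intro: repsD endosD arrs_vert)

lemma moment_carrier:
  "A \<in> reps \<Longrightarrow> B \<in> coreps \<Longrightarrow> moment A B v \<in> carrier_mat (d v) (d v)"
  by (intro minus_carrier_mat out_term_carrier)

lemma pairing_right_kernel:
  fixes A :: "'a::field qrep"
  assumes A: "A \<in> reps" and g: "g \<in> endos"
  shows "(\<forall>B\<in>coreps. pairing A g B = 0) \<longleftrightarrow> qhom_by k l g A A"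
proof
  assume zero: "\<forall>B\<in>coreps. pairing A g B = 0"
  show "qhom_by k l g A A"
    unfolding qhom_by_def
  proof
    fix w0 assume w0: "w0 \<in> arrs k l"
    let ?X = "g (tgt w0) * A w0 - A w0 * g w0"
    have "?X = 0\<^sub>m (d (tgt w0)) (d w0)"
    proof (rule mtrace_nondegenerate[OF arr_carrier[OF A g w0]])
      fix Y :: "'a mat" assume Y: "Y \<in> carrier_mat (d w0) (d (tgt w0))"
      \<comment> \<open>A test family supported on the single arrow \<open>w0\<close> isolates one
        summand of the pairing.\<close>
      define B where "B w = (if w = w0 then Y else if w \<in> arrs k l then 0\<^sub>m (d w) (d (tgt w)) else 0\<^sub>m 0 0)" for w
      have "B \<in> coreps"
        using Y w0 by (auto simp: B_def mat_fams_def)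
      then have "0 = pairing A g B"
        using zero by simp
      also have "\<dots> = (\<Sum>w\<in>arrs k l. if w = w0 then mtrace (?X * Y) else 0)"
        unfolding pairing_def
        by (rule sum.cong[OF refl]) (use mtrace_mult_zero[OF arr_carrier[OF A g]] in \<open>auto simp: B_def\<close>)
      also have "\<dots> = mtrace (?X * Y)"
        using w0 finite_arrs by simp
      finally show "mtrace (?X * Y) = 0" ..
    qed
    then show "g (tgt w0) * A w0 = A w0 * g w0"
      using eq_minus_zero_mat[OF mult_carrier_mat[OF endosD[OF g tgt_vert'[OF w0]] repsD[OF A w0]]
          mult_carrier_mat[OF repsD[OF A w0] endosD[OF g arrs_vert[OF w0]]]]
      by simp
  qed
next
  assume hom: "qhom_by k l g A A"
  have "mtrace ((g (tgt w) * A w - A w * g w) * B w) = 0" if B: "B \<in> coreps" and w: "w \<in> arrs k l" for B w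
  proof -
    have "A w * g w \<in> carrier_mat (d (tgt w)) (d w)"
      using A g w by (auto intro!: mult_carrier_mat[of _ _ "d w"] intro: repsD endosD arrs_vert)
    then have "g (tgt w) * A w - A w * g w = 0\<^sub>m (d (tgt w)) (d w)"
      using hom w by (auto simp: qhom_by_def)
    then show ?thesis
      using corepsD[OF B w] by (simp add: mtrace_zero)
  qed
  then show "\<forall>B\<in>coreps. pairing A g B = 0"
    by (auto simp: pairing_def intro: sum.neutral)
qed

lemma pairing_left_kernel:
  fixes A :: "'a::field qrep"
  assumes A: "A \<in> reps" and B: "B \<in> coreps"
  shows "(\<forall>g\<in>endos. pairing A g B = 0) \<longleftrightarrow> (\<forall>v\<in>vert k l. out_term k l d (A, B) v = in_term k l d (A, B) v)"
proof
  assume zero: "\<forall>g\<in>endos. pairing A g B = 0"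
  show "\<forall>v\<in>vert k l. out_term k l d (A, B) v = in_term k l d (A, B) v"
  proof
    fix v0 assume v0: "v0 \<in> vert k l"
    have "moment A B v0 = 0\<^sub>m (d v0) (d v0)"
    proof (rule mtrace_nondegenerate[OF moment_carrier[OF A B]])
      fix Y :: "'a mat" assume Y: "Y \<in> carrier_mat (d v0) (d v0)"
      define g where "g v = (if v = v0 then Y else if v \<in> vert k l then 0\<^sub>m (d v) (d v) else 0\<^sub>m 0 0)" for v
      have g: "g \<in> endos"
        using Y v0 by (auto simp: g_def mat_fams_def)
      then have "0 = pairing A g B"
        using zero by simp
      also have "\<dots> = (\<Sum>v\<in>vert k l. if v = v0 then mtrace (Y * moment A B v) else 0)"
        unfolding pairing_eq_moment[OF A B g]
        by (rule sum.cong[OF refl])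
          (auto simp: g_def mtrace_zero left_mult_zero_mat[OF moment_carrier[OF A B]])
      also have "\<dots> = mtrace (Y * moment A B v0)"
        using v0 finite_vert by simp
      also have "\<dots> = mtrace (moment A B v0 * Y)"
        by (rule mtrace_commute[OF Y moment_carrier[OF A B]])
      finally show "mtrace (moment A B v0 * Y) = 0" ..
    qed
    then show "out_term k l d (A, B) v0 = in_term k l d (A, B) v0"
      by (subst (asm) eq_minus_zero_mat) (auto intro: in_term_carrier[OF A B] out_term_carrier[OF A B])
  qed
next
  assume eq: "\<forall>v\<in>vert k l. out_term k l d (A, B) v = in_term k l d (A, B) v"
  have "mtrace (g v * moment A B v) = 0" if g: "g \<in> endos" and v: "v \<in> vert k l" for g v
    using eq v endosD[OF g v] in_term_carrier[OF A B, of v] by (simp add: mtrace_zero)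
  then show "\<forall>g\<in>endos. pairing A g B = 0"
    by (auto simp: pairing_eq_moment[OF A B] intro: sum.neutral)
qed

text \<open>\<open>card_kernels_of_pairing\<close> applied to \<open>pairing A\<close>: one kernel
  is End A, the other the set of module structures over A. The exponents are the dimensions of
  \<open>coreps\<close> and \<open>endos\<close>, and their difference is the Euler form.\<close>

lemma card_coreps_fiber:
  fixes A :: "'a::{field,finite} qrep"
  assumes A: "A \<in> reps"
  shows "card {g\<in>endos. qhom_by k l g A A} * CARD('a) ^ (\<Sum>w\<in>arrs k l. d w * d (tgt w))
    = card {B\<in>coreps. \<forall>v\<in>vert k l. out_term k l d (A, B) v = in_term k l d (A, B) v}
      * CARD('a) ^ (\<Sum>v\<in>vert k l. d v * d v)"
proof -
  have fin: "finite (endos :: (int \<Rightarrow> 'a mat) set)" "finite (coreps :: (int \<Rightarrow> 'a mat) set)"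
    by (rule card_mat_fams(1)[OF finite_vert], rule card_mat_fams(1)[OF finite_arrs])
  have "card {g\<in>endos. \<forall>B\<in>coreps. pairing A g B = 0} * card (coreps :: (int \<Rightarrow> 'a mat) set)
    = card {B\<in>coreps. \<forall>g\<in>endos. pairing A g B = 0} * card (endos :: (int \<Rightarrow> 'a mat) set)"
  proof (rule card_kernels_of_pairing[OF fin])
    fix g :: "int \<Rightarrow> 'a mat" assume g: "g \<in> endos" and "\<exists>B\<in>coreps. pairing A g B \<noteq> 0"
    then obtain B0 where B0: "B0 \<in> coreps" "pairing A g B0 \<noteq> 0"
      by blast
    show "CARD('a) * card {B\<in>coreps. pairing A g B = 0} = card (coreps :: (int \<Rightarrow> 'a mat) set)"
    proof (rule card_zero_fiber[of _ B0 _ "\<lambda>c B w. B w + c \<cdot>\<^sub>m B0 w"])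
      fix c and B :: "int \<Rightarrow> 'a mat" assume B: "B \<in> coreps"
      have "pairing A g (\<lambda>w. B w + c \<cdot>\<^sub>m B0 w) = pairing A g B + c * pairing A g B0"
        unfolding pairing_def sum_distrib_left sum.distrib[symmetric]
        by (rule sum.cong[OF refl], rule mtrace_mult_shift[OF arr_carrier[OF A g]])
          (auto intro: corepsD B B0)
      then show "(\<lambda>w. B w + c \<cdot>\<^sub>m B0 w) \<in> coreps
          \<and> pairing A g (\<lambda>w. B w + c \<cdot>\<^sub>m B0 w) = pairing A g B + c * pairing A g B0"
        using mat_fams_shift(1)[OF B B0(1)] by blast
      show "(\<lambda>w. B w + c \<cdot>\<^sub>m B0 w + - c \<cdot>\<^sub>m B0 w) = B"
        by (rule mat_fams_shift(2)[OF B B0(1)])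
    qed (use fin B0 in auto)
  next
    fix B :: "int \<Rightarrow> 'a mat" assume B: "B \<in> coreps" and "\<exists>g\<in>endos. pairing A g B \<noteq> 0"
    then obtain g0 where g0: "g0 \<in> endos" "pairing A g0 B \<noteq> 0"
      by blast
    show "CARD('a) * card {g\<in>endos. pairing A g B = 0} = card (endos :: (int \<Rightarrow> 'a mat) set)"
    proof (rule card_zero_fiber[of _ g0 _ "\<lambda>c g v. g v + c \<cdot>\<^sub>m g0 v"])
      fix c and g :: "int \<Rightarrow> 'a mat" assume g: "g \<in> endos"
      have shift: "(\<lambda>v. g v + c \<cdot>\<^sub>m g0 v) \<in> endos"
        by (rule mat_fams_shift(1)[OF g g0(1)])
      have "mtrace ((g v + c \<cdot>\<^sub>m g0 v) * moment A B v)
          = mtrace (g v * moment A B v) + c * mtrace (g0 v * moment A B v)" if v: "v \<in> vert k l" for v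
        using mtrace_mult_shift[OF moment_carrier[OF A B] endosD[OF g v] endosD[OF g0(1) v]]
          mtrace_commute[OF moment_carrier[OF A B] endosD[OF g v]]
          mtrace_commute[OF moment_carrier[OF A B] endosD[OF g0(1) v]]
          mtrace_commute[OF moment_carrier[OF A B] endosD[OF shift v]]
        by metis
      then have "pairing A (\<lambda>v. g v + c \<cdot>\<^sub>m g0 v) B = pairing A g B + c * pairing A g0 B"
        unfolding pairing_eq_moment[OF A B g] pairing_eq_moment[OF A B g0(1)] pairing_eq_moment[OF A B shift]
        by (simp add: sum.distrib sum_distrib_left)
      with shift show "(\<lambda>v. g v + c \<cdot>\<^sub>m g0 v) \<in> endos
          \<and> pairing A (\<lambda>v. g v + c \<cdot>\<^sub>m g0 v) B = pairing A g B + c * pairing A g0 B"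
        by blast
      show "(\<lambda>v. g v + c \<cdot>\<^sub>m g0 v + - c \<cdot>\<^sub>m g0 v) = g"
        by (rule mat_fams_shift(2)[OF g g0(1)])
    qed (use fin g0 in auto)
  qed
  moreover have "{g\<in>endos. \<forall>B\<in>coreps. pairing A g B = 0} = {g\<in>endos. qhom_by k l g A A}"
    using pairing_right_kernel[OF A] by blast
  moreover have "{B\<in>coreps. \<forall>g\<in>endos. pairing A g B = 0}
      = {B\<in>coreps. \<forall>v\<in>vert k l. out_term k l d (A, B) v = in_term k l d (A, B) v}"
    using pairing_left_kernel[OF A] by blast
  ultimately show ?thesis
    by (simp add: card_mat_fams(2)[OF finite_vert] card_mat_fams(2)[OF finite_arrs])
qed

end

section \<open>The mass over a fixed quiver representation\<close>

context quiver_dims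
begin

text \<open>Conjugation by an isomorphism embeds End A into End A'. Applied in both directions, it
  shows that the fibres over an orbit have equal size.\<close>

lemma card_qhom_conjugate:
  fixes A :: "'a::{field,finite} qrep"
  assumes A: "A \<in> reps" "A' \<in> reps" and iso: "qrep_iso k l d A A'"
  shows "card {g\<in>endos. qhom_by k l g A A} \<le> card {g\<in>endos. qhom_by k l g A' A'}"
proof -
  obtain h where h: "gl_fam k l d h" "qhom_by k l h A A'"
    using iso by (auto simp: qrep_iso_def)
  obtain h' where h': "gl_fam k l d h'"
    "\<And>v. v \<in> vert k l \<Longrightarrow> h v * h' v = 1\<^sub>m (d v)" "\<And>v. v \<in> vert k l \<Longrightarrow> h' v * h v = 1\<^sub>m (d v)"
    using gl_fam_inverse[OF h(1)] by metis
  have hom': "qhom_by k l h' A' A"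
    by (rule qhom_inverse[OF h(1) h'(1) A h'(2,3) h(2)])
  define \<phi> where "\<phi> g = (\<lambda>v. h v * (g v * h' v))" for g
  have mult: "(\<lambda>v. x v * y v) \<in> endos" if "x \<in> endos" "y \<in> endos" for x y :: "int \<Rightarrow> 'a mat"
    using that by (auto simp: mat_fams_def)
  have "inj_on \<phi> {g\<in>endos. qhom_by k l g A A}"
  proof (rule inj_on_inverseI[where g = "\<lambda>g v. if v \<in> vert k l then h' v * (g v * h v) else 0\<^sub>m 0 0"])
    fix g assume "g \<in> {g\<in>endos. qhom_by k l g A A}"
    then have g: "g \<in> endos"
      by simp
    show "(\<lambda>v. if v \<in> vert k l then h' v * (\<phi> g v * h v) else 0\<^sub>m 0 0) = g"
    proof
      fix v
      show "(if v \<in> vert k l then h' v * (\<phi> g v * h v) else 0\<^sub>m 0 0) = g v"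
      proof (cases "v \<in> vert k l")
        case True
        note c = endosD[OF g True] gl_famD[OF h(1) True] gl_famD[OF h'(1) True]
        have "\<phi> g v * h v = h v * (g v * (h' v * h v))"
          using c unfolding \<phi>_def by (simp add: assoc_mult_mat[of _ "d v" "d v" _ "d v" _ "d v"])
        also have "\<dots> = h v * g v"
          using c by (simp add: h'(3)[OF True])
        also have "h' v * (h v * g v) = h' v * h v * g v"
          using assoc_mult_mat[OF c(3,2,1)] ..
        also have "\<dots> = g v"
          using c by (simp add: h'(3)[OF True])
        finally show ?thesis
          using True by simp
      next
        case False
        then show ?thesis
          using g by (simp add: mat_fams_def)
      qed
    qed
  qed
  moreover have "\<phi> ` {g\<in>endos. qhom_by k l g A A} \<subseteq> {g\<in>endos. qhom_by k l g A' A'}"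
    unfolding \<phi>_def
    using mult gl_endos[OF h(1)] gl_endos[OF h'(1)] A hom' h(2) by (auto intro: qhom_trans)
  moreover have "finite {g\<in>endos. qhom_by k l g A' A'}"
    using card_mat_fams(1)[OF finite_vert, where 'a = 'a] by simp
  ultimately show ?thesis
    by (rule card_inj_on_le)
qed

text \<open>Both sides of the relation at v are conjugated by \<open>g v\<close>, which can then be
  cancelled. This closes the set of modules under the action of G.\<close>

lemma pimod_transport:
  fixes V V' :: "'a::field dqrep"
  assumes V: "is_pimod k l d V" and V': "fst V' \<in> reps" "snd V' \<in> coreps"
    and g: "gl_fam k l d g" and hom: "dhom_by k l g V V'"
  shows "is_pimod k l d V'"
proof -
  have c: "fst V \<in> reps" "snd V \<in> coreps"
    using V by (auto simp: is_pimod_iff is_qrep_iff)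
  have A: "fst V w \<in> carrier_mat (d (tgt w)) (d w)" "fst V' w \<in> carrier_mat (d (tgt w)) (d w)"
      "snd V w \<in> carrier_mat (d w) (d (tgt w))" "snd V' w \<in> carrier_mat (d w) (d (tgt w))"
      "g w \<in> carrier_mat (d w) (d w)" "g (tgt w) \<in> carrier_mat (d (tgt w)) (d (tgt w))"
      "g (tgt w) * fst V w = fst V' w * g w" "g w * snd V w = snd V' w * g (tgt w)"
    if "w \<in> arrs k l" for w
    using that c V' hom
    by (auto simp: dhom_by_def qhom_by_def intro: repsD corepsD gl_famD[OF g] arrs_vert tgt_vert')
  have inn: "g (tgt w) * (fst V w * snd V w) = fst V' w * snd V' w * g (tgt w)"
    and out: "g w * (snd V w * fst V w) = snd V' w * fst V' w * g w"
    if w: "w \<in> arrs k l" for w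
    using intertwine_mult[OF A(6,5,1,2,3,4,7,8)[OF w]] intertwine_mult[OF A(5,6,3,4,1,2,8,7)[OF w]]
    by simp_all
  obtain h where h: "gl_fam k l d h"
    "\<And>v. v \<in> vert k l \<Longrightarrow> g v * h v = 1\<^sub>m (d v)"
    using gl_fam_inverse[OF g] by metis
  have "out_term k l d V' v = in_term k l d V' v" if v: "v \<in> vert k l" for v
  proof (rule mult_mat_right_cancel[of _ "d v" "d v" _ "g v" "h v"])
    have gv: "g v \<in> carrier_mat (d v) (d v)"
      by (rule gl_famD[OF g v])
    show "out_term k l d V' v \<in> carrier_mat (d v) (d v)" "in_term k l d V' v \<in> carrier_mat (d v) (d v)"
      using out_term_carrier[OF V'] in_term_carrier[OF V'] by simp_all
    show "g v \<in> carrier_mat (d v) (d v)" "h v \<in> carrier_mat (d v) (d v)" "g v * h v = 1\<^sub>m (d v)"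
      using v by (auto intro: gl_famD[OF g] gl_famD[OF h(1)] h(2))
    have "out_term k l d V' v * g v = g v * out_term k l d V v"
      using gv out[of v] by (simp add: out_term_def)
    also have "out_term k l d V v = in_term k l d V v"
      using V v by (simp add: is_pimod_def)
    also have "g v * in_term k l d V v = in_term k l d V' v * g v"
    proof -
      define X where "X = (\<lambda>V :: 'a dqrep. if v + 1 \<in> arrs k l \<and> tgt (v + 1) = v
        then fst V (v + 1) * snd V (v + 1) else 0\<^sub>m (d v) (d v))"
      define Y where "Y = (\<lambda>V :: 'a dqrep. if v - 1 \<in> arrs k l \<and> tgt (v - 1) = v
        then fst V (v - 1) * snd V (v - 1) else 0\<^sub>m (d v) (d v))"
      have cX: "X V \<in> carrier_mat (d v) (d v)" "Y V \<in> carrier_mat (d v) (d v)"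
        if "fst V \<in> reps" "snd V \<in> coreps" for V
        using repsD[OF that(1), of "v + 1"] repsD[OF that(1), of "v - 1"]
          corepsD[OF that(2), of "v + 1"] corepsD[OF that(2), of "v - 1"]
        by (auto simp: X_def Y_def intro!: mult_carrier_mat)
      have in_eq: "in_term k l d V v = X V + Y V" for V
        by (simp add: in_term_def X_def Y_def)
      have "g v * X V = X V' * g v" "g v * Y V = Y V' * g v"
        using gv inn[of "v + 1"] inn[of "v - 1"] by (auto simp: X_def Y_def)
      then show ?thesis
        unfolding in_eq mult_add_distrib_mat[OF gv cX[OF c]] add_mult_distrib_mat[OF cX[OF V'] gv]
        by simp
    qed
    finally show "out_term k l d V' v * g v = in_term k l d V' v * g v" .
  qed
  then show ?thesis
    using V' by (simp add: is_pimod_iff is_qrep_iff)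
qed

abbreviation "pimods A0 \<equiv> {V. is_pimod k l d V \<and> qrep_iso k l d (fst V) A0}"

lemma pimodsD: "V \<in> pimods A0 \<Longrightarrow> fst V \<in> reps" "V \<in> pimods A0 \<Longrightarrow> snd V \<in> coreps"
  by (auto simp: is_pimod_iff is_qrep_iff)

lemma qrep_iso_iff_rel:
  fixes A A' :: "'a::{field,finite} qrep"
  shows "A \<in> reps \<Longrightarrow> A' \<in> reps \<Longrightarrow> qrep_iso k l d A A' \<longleftrightarrow> (A, A') \<in> qreps.rel"
  by (auto simp: qrep_iso_def qreps.rel_def)

text \<open>The action on modules: its orbits are the isomorphism classes of modules and its
  stabilizers are the groups \<open>Aut\<close>.\<close>

lemma pimods_finite_group_relation:
  fixes A0 :: "'a::{field,finite} qrep"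
  assumes A0: "A0 \<in> reps"
  shows "finite_group_relation {g :: int \<Rightarrow> 'a mat. gl_fam k l d g}
    (\<lambda>h g v. h v * g v) (pimods A0) (dhom_by k l)"
proof
  show "finite {g :: int \<Rightarrow> 'a mat. gl_fam k l d g}"
    by (rule qreps.finite_group)
  have "pimods A0 \<subseteq> reps \<times> coreps"
    by (auto simp: is_pimod_iff is_qrep_iff)
  then show "finite (pimods A0)"
    by (rule finite_subset)
      (auto intro: card_mat_fams(1)[OF finite_arrs, where 'a = 'a])
  show "\<exists>e\<in>{g :: int \<Rightarrow> 'a mat. gl_fam k l d g}. \<forall>V\<in>pimods A0. dhom_by k l e V V"
  proof (intro bexI[of _ "\<lambda>v. if v \<in> vert k l then 1\<^sub>m (d v) else 0\<^sub>m 0 0"] ballI)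
    fix V assume V: "V \<in> pimods A0"
    show "dhom_by k l (\<lambda>v. if v \<in> vert k l then 1\<^sub>m (d v) else 0\<^sub>m 0 0) V V"
      using qhom_one[OF pimodsD(1)[OF V]] corepsD[OF pimodsD(2)[OF V]] tgt_vert'
      by (auto simp: dhom_by_def arrs_vert intro!: left_mult_one_mat[THEN trans] right_mult_one_mat[symmetric])
  qed (simp add: gl_fam_one)
  fix g :: "int \<Rightarrow> 'a mat" assume "g \<in> {g. gl_fam k l d g}"
  then have g: "gl_fam k l d g"
    by simp
  obtain h where h: "gl_fam k l d h"
    "\<And>v. v \<in> vert k l \<Longrightarrow> g v * h v = 1\<^sub>m (d v)" "\<And>v. v \<in> vert k l \<Longrightarrow> h v * g v = 1\<^sub>m (d v)"
    using gl_fam_inverse[OF g] by metis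
  show "\<exists>!V'. V' \<in> pimods A0 \<and> dhom_by k l g V V'" if V: "V \<in> pimods A0" for V
  proof -
    obtain A' where A': "A' \<in> reps" "qhom_by k l g (fst V) A'"
      and uA: "\<And>X. X \<in> reps \<Longrightarrow> qhom_by k l g (fst V) X \<Longrightarrow> X = A'"
      using ex1_qhom[OF g pimodsD(1)[OF V]] by blast
    obtain B' where B': "B' \<in> coreps" "\<forall>w\<in>arrs k l. g w * snd V w = B' w * g (tgt w)"
      and uB: "\<And>X. X \<in> coreps \<Longrightarrow> \<forall>w\<in>arrs k l. g w * snd V w = X w * g (tgt w) \<Longrightarrow> X = B'"
      using ex1_cohom[OF g pimodsD(2)[OF V]] by blast
    have hom: "dhom_by k l g V (A', B')"
      using A' B' by (simp add: dhom_by_def)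
    have "is_pimod k l d (A', B')"
      using V A' B' by (intro pimod_transport[OF _ _ _ g hom]) auto
    moreover have iso: "(fst V, A0) \<in> qreps.rel"
      using V qrep_iso_iff_rel[OF pimodsD(1)[OF V] A0] by simp
    moreover have iso': "(fst V, A') \<in> qreps.rel"
      using pimodsD(1)[OF V] A' g by (auto simp: qreps.rel_def)
    \<comment> \<open>The group moves the underlying representation only within the orbit of
      \<open>A0\<close>, so the condition on the restriction is preserved.\<close>
    moreover have "(A', A0) \<in> qreps.rel"
      by (rule qreps.rel_trans[OF qreps.rel_sym[OF iso'] iso])
    ultimately have "(A', B') \<in> pimods A0"
      using qrep_iso_iff_rel[OF A'(1) A0] by simp
    with hom show ?thesis
    proof (intro ex1I[of _ "(A', B')"] conjI)
      fix V' assume V': "V' \<in> pimods A0 \<and> dhom_by k l g V V'"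
      then have "fst V' \<in> reps" "snd V' \<in> coreps"
        using pimodsD[of V' A0] by simp_all
      with V' have "fst V' = A'" "snd V' = B'"
        by (auto simp: dhom_by_def intro!: uA uB)
      then show "V' = (A', B')"
        by (simp add: prod_eq_iff)
    qed
  qed
  have "dhom_by k l h V U" if "U \<in> pimods A0" "V \<in> pimods A0" "dhom_by k l g U V" for U V
    using that pimodsD[OF that(1)] pimodsD[OF that(2)]
      qhom_inverse[OF g h(1) _ _ h(2,3), of "fst U" "fst V"]
      cohom_inverse[OF g h(1) _ _ h(2,3), of "snd U" "snd V"]
    by (auto simp: dhom_by_def)
  then show "\<exists>h\<in>{g. gl_fam k l d g}. (\<forall>x\<in>{g. gl_fam k l d g}.
      (\<lambda>v. h v * (g v * x v)) = x \<and> (\<lambda>v. g v * (h v * x v)) = x)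
      \<and> (\<forall>U\<in>pimods A0. \<forall>V\<in>pimods A0. dhom_by k l g U V \<longrightarrow> dhom_by k l h V U)"
    using h gl_fam_cancel[OF _ g h(1,3)] gl_fam_cancel[OF _ h(1) g h(2)]
    by (intro bexI[of _ h]) auto
  fix h :: "int \<Rightarrow> 'a mat" assume "h \<in> {g. gl_fam k l d g}"
  then have h: "gl_fam k l d h"
    by simp
  show "(\<lambda>v. h v * g v) \<in> {g. gl_fam k l d g}"
    using gl_fam_mult[OF g h] by simp
  fix U V W assume UVW: "U \<in> pimods A0" "V \<in> pimods A0" "W \<in> pimods A0"
    "dhom_by k l g U V" "dhom_by k l h V W"
  show "dhom_by k l (\<lambda>v. h v * g v) U W"
    using UVW(4,5) pimodsD[OF UVW(1)] pimodsD[OF UVW(2)] pimodsD[OF UVW(3)]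
      qhom_trans[OF gl_endos[OF g] gl_endos[OF h], of "fst U" "fst V" "fst W"]
      cohom_trans[OF g h, of "snd U" "snd V" "snd W"]
    by (auto simp: dhom_by_def)
qed

text \<open>The modules fibre over the orbit of \<open>A0\<close>. The orbit size comes from
  \<open>orbit_stabilizer\<close>, the common fibre size from \<open>card_coreps_fiber\<close>; the
  result is kept free of denominators to stay in the natural numbers.\<close>

lemma card_pimods:
  fixes A0 :: "'a::{field,finite} qrep"
  assumes A0: "A0 \<in> reps"
  shows "card (pimods A0) * CARD('a) ^ (\<Sum>v\<in>vert k l. d v * d v) * card {g. gl_fam k l d g \<and> qhom_by k l g A0 A0}
    = card {g\<in>endos. qhom_by k l g A0 A0} * CARD('a) ^ (\<Sum>w\<in>arrs k l. d w * d (tgt w))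
      * card {g :: int \<Rightarrow> 'a mat. gl_fam k l d g}"
proof -
  let ?F = "\<lambda>A :: 'a qrep. {B\<in>coreps. \<forall>v\<in>vert k l. out_term k l d (A, B) v = in_term k l d (A, B) v}"
  let ?O = "qreps.rel `` {A0}"
  have finF: "finite (?F A)" for A
    using card_mat_fams(1)[OF finite_arrs, where 'a = 'a] by simp
  have OX: "A \<in> reps" "qrep_iso k l d A A0" "qrep_iso k l d A0 A" if "A \<in> ?O" for A
    using that qreps.rel_sym[of A0 A] qrep_iso_iff_rel[of A A0] qrep_iso_iff_rel[of A0 A] A0
    by (auto simp: qreps.rel_def)
  have cardF: "card (?F A) = card (?F A0)" if "A \<in> ?O" for A
  proof -
    have "card {g\<in>endos. qhom_by k l g A A} = card {g\<in>endos. qhom_by k l g A0 A0}"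
      by (intro antisym card_qhom_conjugate A0 OX[OF that])
    then have "card (?F A) * CARD('a) ^ (\<Sum>v\<in>vert k l. d v * d v)
        = card (?F A0) * CARD('a) ^ (\<Sum>v\<in>vert k l. d v * d v)"
      using card_coreps_fiber[OF OX(1)[OF that]] card_coreps_fiber[OF A0] by simp
    then show ?thesis
      by simp
  qed
  have "pimods A0 = (SIGMA A:?O. ?F A)"
  proof -
    have "(a, A0) \<in> qreps.rel \<longleftrightarrow> (A0, a) \<in> qreps.rel" for a
      by (blast intro: qreps.rel_sym)
    then show ?thesis
      using OX qrep_iso_iff_rel[OF _ A0] by (auto simp: is_pimod_iff is_qrep_iff)
  qed
  moreover have "finite ?O"
    by (rule finite_subset[OF _ qreps.finite_space]) (auto simp: qreps.rel_def)
  ultimately have "card (pimods A0) = (\<Sum>A\<in>?O. card (?F A))"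
    using finF by simp
  also have "\<dots> = card ?O * card (?F A0)"
    using cardF by simp
  finally have "card (pimods A0) = card ?O * card (?F A0)" .
  then show ?thesis
    using qreps.orbit_stabilizer[OF A0] card_coreps_fiber[OF A0] by (simp add: mult_ac)
qed

proposition mass_eq:
  fixes A0 :: "'a::{field,finite} qrep"
  assumes A0: "A0 \<in> reps"
  shows "(\<Sum>C\<in>pimods A0 // {(V, V'). V \<in> pimods A0 \<and> V' \<in> pimods A0 \<and> pimod_iso k l d V V'}.
      1 / real (card (Aut k l d (SOME V. V \<in> C))))
    = real CARD('a) ^ (\<Sum>w\<in>arrs k l. d w * d (tgt w)) * real (card {g\<in>endos. qhom_by k l g A0 A0})
      / (real CARD('a) ^ (\<Sum>v\<in>vert k l. d v * d v)
        * real (card {g. gl_fam k l d g \<and> qhom_by k l g A0 A0}))"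
proof -
  interpret P: finite_group_relation "{g :: int \<Rightarrow> 'a mat. gl_fam k l d g}"
    "\<lambda>h g v. h v * g v" "pimods A0" "dhom_by k l"
    by (rule pimods_finite_group_relation[OF A0])
  have rel: "P.rel = {(V, V'). V \<in> pimods A0 \<and> V' \<in> pimods A0 \<and> pimod_iso k l d V V'}"
    by (auto simp: P.rel_def pimod_iso_def)
  have Aut: "Aut k l d V = {g\<in>{g. gl_fam k l d g}. dhom_by k l g V V}" for V :: "'a dqrep"
    by (simp add: Aut_def)
  let ?a = "\<Sum>v\<in>vert k l. d v * d v" and ?b = "\<Sum>w\<in>arrs k l. d w * d (tgt w)"
  let ?S = "{g. gl_fam k l d g \<and> qhom_by k l g A0 A0}"
  have "(\<lambda>v. if v \<in> vert k l then 1\<^sub>m (d v) else 0\<^sub>m 0 0) \<in> ?S"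
    using gl_fam_one qhom_one[OF A0] by simp
  moreover have "?S \<subseteq> {g. gl_fam k l d g}" "finite {g :: int \<Rightarrow> 'a mat. gl_fam k l d g}"
    using P.finite_group by auto
  ultimately have pos: "card ?S > 0" "card {g :: int \<Rightarrow> 'a mat. gl_fam k l d g} > 0"
    by (auto simp: card_gt_0_iff intro: finite_subset)
  have "real (card (pimods A0)) * real CARD('a) ^ ?a * real (card ?S)
      = real (card {g\<in>endos. qhom_by k l g A0 A0}) * real CARD('a) ^ ?b
        * real (card {g :: int \<Rightarrow> 'a mat. gl_fam k l d g})"
    using arg_cong[OF card_pimods[OF A0], of real] by simp
  then have "real (card (pimods A0)) / real (card {g :: int \<Rightarrow> 'a mat. gl_fam k l d g})
      = real CARD('a) ^ ?b * real (card {g\<in>endos. qhom_by k l g A0 A0}) / (real CARD('a) ^ ?a * real (card ?S))"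
    using pos by (simp add: field_simps)
  then show ?thesis
    using P.sum_inverse_stabilizer unfolding rel Aut by simp
qed

end

section \<open>The representation \<open>V\<^sub>M\<close>\<close>

text \<open>The link between \<open>gl_fam\<close>, which speaks of inverses, and
  \<open>triv_ker\<close>; the passage from the kernel to an inverse goes through the
  determinant.\<close>

lemma invertible_mat_iff_trivial_kernel:
  fixes A :: "'a::field mat"
  assumes A: "A \<in> carrier_mat n n"
  shows "invertible_mat A \<longleftrightarrow> (\<forall>u\<in>carrier_vec n. A *\<^sub>v u = 0\<^sub>v n \<longrightarrow> u = 0\<^sub>v n)"
proof
  assume "invertible_mat A"
  then obtain B where B: "B \<in> carrier_mat n n" "B * A = 1\<^sub>m n"
    using invertible_mat_iff[OF A] by blast
  show "\<forall>u\<in>carrier_vec n. A *\<^sub>v u = 0\<^sub>v n \<longrightarrow> u = 0\<^sub>v n"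
  proof (intro ballI impI)
    fix u :: "'a vec" assume u: "u \<in> carrier_vec n" "A *\<^sub>v u = 0\<^sub>v n"
    have "u = B * A *\<^sub>v u"
      using B u by simp
    also have "\<dots> = B *\<^sub>v (A *\<^sub>v u)"
      by (rule assoc_mult_mat_vec[OF B(1) A u(1)])
    also have "\<dots> = 0\<^sub>v n"
      unfolding u(2) using B(1) by (auto intro!: eq_vecI)
    finally show "u = 0\<^sub>v n" .
  qed
next
  assume "\<forall>u\<in>carrier_vec n. A *\<^sub>v u = 0\<^sub>v n \<longrightarrow> u = 0\<^sub>v n"
  then have "det A \<noteq> 0"
    using det_0_iff_vec_prod_zero_field[OF A] by blast
  then show "invertible_mat A"
    using det_non_zero_imp_unit[OF A, of "()"] invertible_mat_iff[OF A]
    by (auto simp: Units_def ring_mat_def)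
qed

lemma distinct_concat_map:
  assumes "distinct xs" "\<And>x. x \<in> set xs \<Longrightarrow> distinct (f x)"
    and "\<And>x y. x \<noteq> y \<Longrightarrow> set (f x) \<inter> set (f y) = {}"
  shows "distinct (concat (map f xs))"
  using assms by (induction xs) (auto simp: disjoint_iff, metis)

lemma set_VM_basis: "set (VM_basis k l M v) = {(i, j, c). 1 \<le> i \<and> i \<le> k \<and> 1 \<le> j \<and> j \<le> l \<and> c < M i j
    \<and> - int l + int j \<le> v \<and> v \<le> int k - int i}"
  by (auto simp: VM_basis_def split: if_splits)

lemma distinct_VM_basis: "distinct (VM_basis k l M v)"
  unfolding VM_basis_def by (intro distinct_concat_map distinct_upt) (auto split: if_splits)

locale VM_setup =
  fixes k l :: nat and M :: "nat \<Rightarrow> nat \<Rightarrow> nat"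
  assumes kl: "1 \<le> k" "1 \<le> l"
begin

sublocale quiver_dims k l "VM_dim k l M"
  by unfold_locales (rule kl)+

abbreviation "basis \<equiv> VM_basis k l M"
abbreviation "dimv \<equiv> VM_dim k l M"
text \<open>Every summand lives at vertex 0, because j - l <= 0 <= k - i; hence the basis there
  contains all labels.\<close>

abbreviation "labels \<equiv> set (basis 0)"

definition pos :: "int \<Rightarrow> nat \<times> nat \<times> nat \<Rightarrow> nat" where
  "pos v = the_inv_into {..<dimv v} ((!) (basis v))"

text \<open>The multiplicity index is ignored, so this is only a preorder, and its classes are the
  blocks of sizes \<open>M i j\<close>.\<close>

definition label_le :: "nat \<times> nat \<times> nat \<Rightarrow> nat \<times> nat \<times> nat \<Rightarrow> bool" where
  "label_le x y \<longleftrightarrow> fst x \<le> fst y \<and> fst (snd x) \<le> fst (snd y)"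

lemma bij_basis: "bij_betw ((!) (basis v)) {..<dimv v} (set (basis v))"
  by (rule bij_betw_nth) (simp_all add: distinct_VM_basis VM_dim_def)

lemma basis_nth: "r < dimv v \<Longrightarrow> basis v ! r \<in> set (basis v)"
  by (simp add: VM_dim_def)

lemma pos_nth: "r < dimv v \<Longrightarrow> pos v (basis v ! r) = r"
  unfolding pos_def using bij_basis by (intro the_inv_into_f_f) (auto simp: bij_betw_def)

lemma pos_less: "x \<in> set (basis v) \<Longrightarrow> pos v x < dimv v"
  and nth_pos: "x \<in> set (basis v) \<Longrightarrow> basis v ! pos v x = x"
proof -
  assume x: "x \<in> set (basis v)"
  then obtain r where "r < dimv v" "x = basis v ! r"
    by (metis in_set_conv_nth VM_dim_def)
  then show "pos v x < dimv v" "basis v ! pos v x = x"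
    by (simp_all add: pos_nth)
qed

lemma sum_basis: "(\<Sum>x\<in>set (basis v). f x) = (\<Sum>r<dimv v. f (basis v ! r))"
  by (rule sum.reindex_bij_betw[OF bij_basis, symmetric])

lemma basis_labels: "set (basis v) \<subseteq> labels"
  by (auto simp: set_VM_basis)

lemma basis_tgt: "w \<in> arrs k l \<Longrightarrow> set (basis w) \<subseteq> set (basis (tgt w))"
  by (auto simp: set_VM_basis arrs_def tgt_def)

text \<open>The label (i, j, c) lives on the interval from j - l to k - i, so smaller i and j mean a
  larger interval. Containment is detected at the two end vertices of the interval of y.\<close>

lemma label_le_iff:
  assumes "x \<in> labels" "y \<in> labels"
  shows "label_le x y \<longleftrightarrow> (\<forall>v\<in>vert k l. y \<in> set (basis v) \<longrightarrow> x \<in> set (basis v))"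
proof -
  obtain i j c i' j' c' where xy: "x = (i, j, c)" "y = (i', j', c')"
    by (cases x; cases y) auto
  show ?thesis
  proof
    assume "label_le x y"
    then show "\<forall>v\<in>vert k l. y \<in> set (basis v) \<longrightarrow> x \<in> set (basis v)"
      using assms by (auto simp: xy label_le_def set_VM_basis)
  next
    assume *: "\<forall>v\<in>vert k l. y \<in> set (basis v) \<longrightarrow> x \<in> set (basis v)"
    have "int k - int i' \<in> vert k l" "int j' - int l \<in> vert k l"
      using assms by (auto simp: xy set_VM_basis vert_def)
    with * assms show "label_le x y"
      using bspec[OF *, of "int k - int i'"] bspec[OF *, of "int j' - int l"]
      by (simp add: xy label_le_def set_VM_basis)
  qed
qed

section \<open>Endomorphisms of VM as matrices indexed by labels\<close>

lemma VM_reps: "(VM k l M :: 'a::field qrep) \<in> reps"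
  by (auto simp: mat_fams_def VM_def)

lemma VM_entry:
  assumes "w \<in> arrs k l" "r < dimv (tgt w)" "s < dimv w"
  shows "(VM k l M w :: 'a::field mat) $$ (r, s) = (if basis (tgt w) ! r = basis w ! s then 1 else 0)"
  using assms by (simp add: VM_def)

text \<open>An arrow of \<open>VM\<close> is the inclusion of a set of labels: multiplying by it on
  the right selects columns, on the left it pads with zero rows. In terms of labels the commutation
  relation therefore becomes an equality of entries.\<close>

lemma qhom_VM_iff:
  fixes g :: "int \<Rightarrow> 'a::field mat"
  assumes g: "g \<in> endos"
  shows "qhom_by k l g (VM k l M) (VM k l M) \<longleftrightarrow>
    (\<forall>w\<in>arrs k l. \<forall>x\<in>set (basis (tgt w)). \<forall>y\<in>set (basis w).
      g (tgt w) $$ (pos (tgt w) x, pos (tgt w) y)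
        = (if x \<in> set (basis w) then g w $$ (pos w x, pos w y) else 0))"
proof -
  have "g (tgt w) * VM k l M w = VM k l M w * g w \<longleftrightarrow>
      (\<forall>x\<in>set (basis (tgt w)). \<forall>y\<in>set (basis w).
      g (tgt w) $$ (pos (tgt w) x, pos (tgt w) y)
        = (if x \<in> set (basis w) then g w $$ (pos w x, pos w y) else 0))" if w: "w \<in> arrs k l" for w
  proof -
    let ?t = "tgt w"
    let ?V = "VM k l M w :: 'a mat"
    have c: "g ?t \<in> carrier_mat (dimv ?t) (dimv ?t)" "g w \<in> carrier_mat (dimv w) (dimv w)"
        "?V \<in> carrier_mat (dimv ?t) (dimv w)"
      using w g by (auto intro: endosD arrs_vert tgt_vert' repsD[OF VM_reps])
    have left: "(g ?t * ?V) $$ (pos ?t x, pos w y) = g ?t $$ (pos ?t x, pos ?t y)"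
      if x: "x \<in> set (basis ?t)" and y: "y \<in> set (basis w)" for x y
    proof -
      have y': "y \<in> set (basis ?t)"
        using y basis_tgt[OF w] by blast
      have "(g ?t * ?V) $$ (pos ?t x, pos w y) = (\<Sum>p<dimv ?t. g ?t $$ (pos ?t x, p) * ?V $$ (p, pos w y))"
        using c pos_less[OF x] pos_less[OF y] by (simp add: scalar_prod_def lessThan_atLeast0)
      also have "\<dots> = (\<Sum>p<dimv ?t. if p = pos ?t y then g ?t $$ (pos ?t x, p) else 0)"
        by (rule sum.cong) (use w y pos_less[OF y] in \<open>auto simp: VM_entry nth_pos pos_nth nth_pos[OF y']\<close>)
      also have "\<dots> = g ?t $$ (pos ?t x, pos ?t y)"
        using pos_less[OF y'] by simp
      finally show ?thesis .
    qed
    have right: "(?V * g w) $$ (pos ?t x, pos w y) = (if x \<in> set (basis w) then g w $$ (pos w x, pos w y) else 0)"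
      if x: "x \<in> set (basis ?t)" and y: "y \<in> set (basis w)" for x y
    proof -
      have "(?V * g w) $$ (pos ?t x, pos w y) = (\<Sum>p<dimv w. ?V $$ (pos ?t x, p) * g w $$ (p, pos w y))"
        using c pos_less[OF x] pos_less[OF y] by (simp add: scalar_prod_def lessThan_atLeast0)
      also have "\<dots> = (\<Sum>p<dimv w. (if basis w ! p = x then 1 else 0) * g w $$ (p, pos w y))"
        by (rule sum.cong) (use w x pos_less[OF x] in \<open>auto simp: VM_entry nth_pos\<close>)
      also have "\<dots> = (\<Sum>p<dimv w. if p = pos w x \<and> x \<in> set (basis w) then g w $$ (p, pos w y) else 0)"
        by (rule sum.cong) (auto simp: pos_nth nth_pos basis_nth)
      also have "\<dots> = (if x \<in> set (basis w) then g w $$ (pos w x, pos w y) else 0)"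
        using pos_less[of x w] by (cases "x \<in> set (basis w)") auto
      finally show ?thesis .
    qed
    have "g ?t * ?V = ?V * g w \<longleftrightarrow> (\<forall>r<dimv ?t. \<forall>s<dimv w. (g ?t * ?V) $$ (r, s) = (?V * g w) $$ (r, s))"
      using c by (auto simp: mat_eq_iff simp del: index_mult_mat(1))
    also have "\<dots> \<longleftrightarrow> (\<forall>x\<in>set (basis ?t). \<forall>y\<in>set (basis w).
        (g ?t * ?V) $$ (pos ?t x, pos w y) = (?V * g w) $$ (pos ?t x, pos w y))"
      by (metis pos_less pos_nth basis_nth)
    finally show ?thesis
      by (simp add: left right)
  qed
  then show ?thesis
    by (simp add: qhom_by_def)
qed

text \<open>The arrows of \<open>V\<^sub>M\<close> are inclusions toward vertex 0, so an endomorphism is determined by its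
  component there.\<close>

lemma qhom_VM_restrict:
  fixes g :: "int \<Rightarrow> 'a::field mat"
  assumes g: "g \<in> endos" and hom: "qhom_by k l g (VM k l M) (VM k l M)"
  shows "v \<in> vert k l \<Longrightarrow> x \<in> labels \<Longrightarrow> y \<in> set (basis v) \<Longrightarrow>
    g 0 $$ (pos 0 x, pos 0 y) = (if x \<in> set (basis v) then g v $$ (pos v x, pos v y) else 0)"
proof (induction "nat \<bar>v\<bar>" arbitrary: v rule: less_induct)
  case less
  show ?case
  proof (cases "v = 0")
    case True
    then show ?thesis
      using less by simp
  next
    case False
    then have v: "v \<in> arrs k l"
      using less by (simp add: arrs_def)
    have "nat \<bar>tgt v\<bar> < nat \<bar>v\<bar>"
      using False by (auto simp: tgt_def)
    moreover have "y \<in> set (basis (tgt v))"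
      using basis_tgt[OF v] less.prems by blast
    ultimately have "g 0 $$ (pos 0 x, pos 0 y)
        = (if x \<in> set (basis (tgt v)) then g (tgt v) $$ (pos (tgt v) x, pos (tgt v) y) else 0)"
      using less v by (intro less.hyps) (auto intro: tgt_vert')
    then show ?thesis
      using hom less.prems v basis_tgt[OF v] unfolding qhom_VM_iff[OF g] by auto
  qed
qed

definition to_inc :: "(int \<Rightarrow> 'a::field mat) \<Rightarrow> nat \<times> nat \<times> nat \<Rightarrow> nat \<times> nat \<times> nat \<Rightarrow> 'a" where
  "to_inc g x y = (if x \<in> labels \<and> y \<in> labels then g 0 $$ (pos 0 x, pos 0 y) else 0)"

definition of_inc :: "(nat \<times> nat \<times> nat \<Rightarrow> nat \<times> nat \<times> nat \<Rightarrow> 'a::field) \<Rightarrow> int \<Rightarrow> 'a mat" where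
  "of_inc f v = (if v \<in> vert k l then mat (dimv v) (dimv v) (\<lambda>(r, s). f (basis v ! r) (basis v ! s))
    else 0\<^sub>m 0 0)"

lemma zero_vert: "0 \<in> vert k l"
  using kl by (simp add: vert_def)

lemma to_inc_restrict:
  fixes g :: "int \<Rightarrow> 'a::field mat"
  assumes "g \<in> endos" "qhom_by k l g (VM k l M) (VM k l M)"
    and "v \<in> vert k l" "x \<in> labels" "y \<in> set (basis v)"
  shows "to_inc g x y = (if x \<in> set (basis v) then g v $$ (pos v x, pos v y) else 0)"
  using qhom_VM_restrict[OF assms] assms(4,5) basis_labels[of v] by (auto simp: to_inc_def)

text \<open>A nonzero entry at (x, y) forces x to live at every vertex where y does, which is
  \<open>label_le x y\<close>. Conversely, this support condition lets a matrix at vertex 0 restrict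
  compatibly to all vertices.\<close>

lemma bij_to_inc:
  "bij_betw to_inc {g :: int \<Rightarrow> 'a::field mat. g \<in> endos \<and> qhom_by k l g (VM k l M) (VM k l M)} (inc labels label_le)"
proof (rule bij_betw_byWitness[where f' = of_inc])
  let ?E = "{g :: int \<Rightarrow> 'a mat. g \<in> endos \<and> qhom_by k l g (VM k l M) (VM k l M)}"
  show "\<forall>g\<in>?E. of_inc (to_inc g) = g"
  proof
    fix g assume g: "g \<in> ?E"
    show "of_inc (to_inc g) = g"
    proof
      fix v
      show "of_inc (to_inc g) v = g v"
      proof (cases "v \<in> vert k l")
        case True
        then have gv: "g v \<in> carrier_mat (dimv v) (dimv v)"
          using g by (auto intro: endosD)
        show ?thesis
        proof (rule eq_matI)
          fix r s assume "r < dim_row (g v)" "s < dim_col (g v)"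
          then have rs: "r < dimv v" "s < dimv v"
            using gv by auto
          have "to_inc g (basis v ! r) (basis v ! s) = g v $$ (r, s)"
            using g True rs basis_labels[of v]
            by (subst to_inc_restrict[of g v]) (auto simp: basis_nth pos_nth)
          then show "of_inc (to_inc g) v $$ (r, s) = g v $$ (r, s)"
            using True rs by (simp add: of_inc_def)
        qed (use gv True in \<open>auto simp: of_inc_def\<close>)
      next
        case False
        then show ?thesis
          using g by (auto simp: of_inc_def mat_fams_def)
      qed
    qed
  qed
  have entry: "of_inc f v $$ (pos v x, pos v y) = f x y"
    if "v \<in> vert k l" "x \<in> set (basis v)" "y \<in> set (basis v)" for f :: "_ \<Rightarrow> _ \<Rightarrow> 'a" and v x y
    using that by (simp add: of_inc_def pos_less nth_pos)
  show "\<forall>f\<in>inc labels label_le. to_inc (of_inc f) = (f :: _ \<Rightarrow> _ \<Rightarrow> 'a)"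
  proof (intro ballI ext)
    fix f :: "_ \<Rightarrow> _ \<Rightarrow> 'a" and x y assume "f \<in> inc labels label_le"
    then have "f x y = 0" if "\<not> (x \<in> labels \<and> y \<in> labels)"
      using that unfolding inc_def by blast
    then show "to_inc (of_inc f) x y = f x y"
      using entry[OF zero_vert] by (auto simp: to_inc_def)
  qed
  show "to_inc ` ?E \<subseteq> inc labels label_le"
  proof clarify
    fix g :: "int \<Rightarrow> 'a mat" assume g: "g \<in> endos" "qhom_by k l g (VM k l M) (VM k l M)"
    have "label_le x y" if nz: "to_inc g x y \<noteq> 0" and xy: "x \<in> labels" "y \<in> labels" for x y
      unfolding label_le_iff[OF xy]
      using to_inc_restrict[OF g _ xy(1)] nz by (metis (full_types))
    then show "to_inc g \<in> inc labels label_le"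
      by (auto simp: inc_def to_inc_def)
  qed
  show "of_inc ` inc labels label_le \<subseteq> ?E"
  proof clarify
    fix f :: "nat \<times> nat \<times> nat \<Rightarrow> nat \<times> nat \<times> nat \<Rightarrow> 'a" assume f: "f \<in> inc labels label_le"
    have endo: "of_inc f \<in> endos"
      by (auto simp: of_inc_def mat_fams_def)
    moreover have "qhom_by k l (of_inc f) (VM k l M) (VM k l M)"
      unfolding qhom_VM_iff[OF endo]
    proof (intro ballI)
      fix w x y assume w: "w \<in> arrs k l" and x: "x \<in> set (basis (tgt w))" and y: "y \<in> set (basis w)"
      have lab: "x \<in> labels" "y \<in> labels" "y \<in> set (basis (tgt w))"
        using x y basis_labels basis_tgt[OF w] by blast+
      have "f x y = 0" if "x \<notin> set (basis w)"
        using that f label_le_iff[OF lab(1,2)] y arrs_vert[OF w] unfolding inc_def by blast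
      then show "of_inc f (tgt w) $$ (pos (tgt w) x, pos (tgt w) y)
          = (if x \<in> set (basis w) then of_inc f w $$ (pos w x, pos w y) else 0)"
        using entry[OF tgt_vert'[OF w] x lab(3)] entry[OF arrs_vert[OF w] _ y] by simp
    qed
    ultimately show "of_inc f \<in> endos \<and> qhom_by k l (of_inc f) (VM k l M) (VM k l M)" ..
  qed
qed

text \<open>Invertibility at vertex 0 is enough: the other components are restrictions to subspaces
  spanned by labels, so a kernel vector at v, extended by zero, is a kernel vector at 0.\<close>

lemma gl_fam_iff_triv_ker:
  fixes g :: "int \<Rightarrow> 'a::field mat"
  assumes g: "g \<in> endos" "qhom_by k l g (VM k l M) (VM k l M)"
  shows "gl_fam k l dimv g \<longleftrightarrow> triv_ker labels (to_inc g)"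
proof
  assume gl: "gl_fam k l dimv g"
  have g0: "g 0 \<in> carrier_mat (dimv 0) (dimv 0)" "invertible_mat (g 0)"
    using gl zero_vert by (auto simp: gl_fam_def)
  show "triv_ker labels (to_inc g)"
    unfolding triv_ker_def
  proof (intro allI impI)
    fix f :: "nat \<times> nat \<times> nat \<Rightarrow> 'a"
    assume f: "\<forall>x\<in>labels. (\<Sum>y\<in>labels. to_inc g x y * f y) = 0"
    define u where "u = vec (dimv 0) (\<lambda>r. f (basis 0 ! r))"
    have "g 0 *\<^sub>v u = 0\<^sub>v (dimv 0)"
    proof (rule eq_vecI)
      fix r assume "r < dim_vec (0\<^sub>v (dimv 0) :: 'a vec)"
      then have r: "r < dimv 0"
        by simp
      have "(g 0 *\<^sub>v u) $ r = (\<Sum>s<dimv 0. g 0 $$ (r, s) * f (basis 0 ! s))"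
        using g0 r by (simp add: u_def scalar_prod_def lessThan_atLeast0)
      also have "\<dots> = (\<Sum>y\<in>labels. to_inc g (basis 0 ! r) y * f y)"
        unfolding sum_basis by (rule sum.cong) (use r in \<open>auto simp: to_inc_def basis_nth pos_nth\<close>)
      finally show "(g 0 *\<^sub>v u) $ r = 0\<^sub>v (dimv 0) $ r"
        using f r basis_nth[OF r] by simp
    qed (use g0 in simp)
    then have u0: "u = 0\<^sub>v (dimv 0)"
      using g0 invertible_mat_iff_trivial_kernel[OF g0(1)] by (simp add: u_def)
    show "\<forall>x\<in>labels. f x = 0"
    proof
      fix x assume x: "x \<in> labels"
      have "u $ pos 0 x = 0"
        unfolding u0 using pos_less[OF x] by simp
      then show "f x = 0"
        using pos_less[OF x] nth_pos[OF x] by (simp add: u_def)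
    qed
  qed
next
  assume t: "triv_ker labels (to_inc g)"
  have "invertible_mat (g v)" if v: "v \<in> vert k l" for v
  proof -
    have gv: "g v \<in> carrier_mat (dimv v) (dimv v)"
      using g(1) v by (rule endosD)
    show ?thesis
      unfolding invertible_mat_iff_trivial_kernel[OF gv]
    proof (intro ballI impI)
      fix u assume u: "u \<in> carrier_vec (dimv v)" "g v *\<^sub>v u = 0\<^sub>v (dimv v)"
      define f where "f y = (if y \<in> set (basis v) then u $ pos v y else 0)" for y
      have "(\<Sum>y\<in>labels. to_inc g x y * f y) = 0" if x: "x \<in> labels" for x
      proof -
        have "(\<Sum>y\<in>labels. to_inc g x y * f y) = (\<Sum>y\<in>set (basis v). to_inc g x y * f y)"
          by (rule sum.mono_neutral_right) (auto simp: f_def dest: subsetD[OF basis_labels])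
        also have "\<dots> = (\<Sum>s<dimv v. to_inc g x (basis v ! s) * u $ s)"
          unfolding sum_basis by (rule sum.cong) (auto simp: f_def basis_nth pos_nth)
        also have "\<dots> = 0"
        proof (cases "x \<in> set (basis v)")
          case True
          have "(\<Sum>s<dimv v. to_inc g x (basis v ! s) * u $ s) = (\<Sum>s<dimv v. g v $$ (pos v x, s) * u $ s)"
            by (rule sum.cong) (use True to_inc_restrict[OF g v x] in \<open>auto simp: basis_nth pos_nth\<close>)
          also have "\<dots> = (g v *\<^sub>v u) $ pos v x"
            using gv u(1) pos_less[OF True] by (simp add: scalar_prod_def lessThan_atLeast0)
          finally show ?thesis
            using u pos_less[OF True] by simp
        next
          case False
          then show ?thesis
            by (intro sum.neutral) (use to_inc_restrict[OF g v x] in \<open>auto simp: basis_nth\<close>)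
        qed
        finally show ?thesis .
      qed
      then have f0: "\<forall>x\<in>labels. f x = 0"
        using t unfolding triv_ker_def by blast
      show "u = 0\<^sub>v (dimv v)"
      proof (rule eq_vecI)
        fix r assume "r < dim_vec (0\<^sub>v (dimv v) :: 'a vec)"
        then have r: "r < dimv v"
          by simp
        then have "f (basis v ! r) = 0"
          using f0 basis_labels[of v] basis_nth by blast
        then show "u $ r = 0\<^sub>v (dimv v) $ r"
          using r by (simp add: f_def basis_nth pos_nth)
      qed (use u in simp)
    qed
  qed
  then show "gl_fam k l dimv g"
    using g(1) by (auto simp: gl_fam_def mat_fams_def)
qed

lemma card_Aut_VM:
  "card {g :: int \<Rightarrow> 'a::{finite,field} mat. gl_fam k l dimv g \<and> qhom_by k l g (VM k l M) (VM k l M)}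
    = card (inc_units labels label_le :: (nat \<times> nat \<times> nat \<Rightarrow> nat \<times> nat \<times> nat \<Rightarrow> 'a) set)"
proof -
  define E where "E = {g :: int \<Rightarrow> 'a mat. g \<in> endos \<and> qhom_by k l g (VM k l M) (VM k l M)}"
  have bij: "bij_betw to_inc E (inc labels label_le)"
    unfolding E_def by (rule bij_to_inc)
  have A: "{g. gl_fam k l dimv g \<and> qhom_by k l g (VM k l M) (VM k l M)} = {g\<in>E. triv_ker labels (to_inc g)}"
    unfolding E_def using gl_fam_iff_triv_ker gl_endos by blast
  have "to_inc ` {g\<in>E. triv_ker labels (to_inc g)} = {f\<in>to_inc ` E. triv_ker labels f}"
    by auto
  then have "to_inc ` {g\<in>E. triv_ker labels (to_inc g)} = inc_units labels label_le"
    unfolding bij_betw_imp_surj_on[OF bij] inc_units_def .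
  then have "bij_betw to_inc {g\<in>E. triv_ker labels (to_inc g)} (inc_units labels label_le)"
    by (intro bij_betw_subset[OF bij]) auto
  then show ?thesis
    unfolding A by (rule bij_betw_same_card)
qed

section \<open>The dimension vector of VM and its Euler form\<close>

lemma dimv_nonneg:
  assumes "i0 \<in> {1..k}"
  shows "dimv (int k - int i0) = (\<Sum>i=1..i0. \<Sum>j=1..l. M i j)"
proof -
  \<comment> \<open>The vertex k - i0 is nonnegative, so the lower bound j - l holds for every j and
    only i <= i0 remains.\<close>
  have "set (basis (int k - int i0)) = (SIGMA i:{1..i0}. SIGMA j:{1..l}. {..<M i j})"
    using assms by (auto simp: set_VM_basis)
  then have "card (set (basis (int k - int i0))) = (\<Sum>i=1..i0. \<Sum>j=1..l. M i j)"
    by simp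
  then show ?thesis
    by (simp add: VM_dim_def distinct_card[OF distinct_VM_basis])
qed

lemma dimv_nonpos:
  assumes "j0 \<in> {1..l}"
  shows "dimv (int j0 - int l) = (\<Sum>j=1..j0. \<Sum>i=1..k. M i j)"
proof -
  have "set (basis (int j0 - int l)) = (SIGMA i:{1..k}. SIGMA j:{1..j0}. {..<M i j})"
    using assms by (auto simp: set_VM_basis)
  then have "card (set (basis (int j0 - int l))) = (\<Sum>i=1..k. \<Sum>j=1..j0. M i j)"
    by simp
  also have "\<dots> = (\<Sum>j=1..j0. \<Sum>i=1..k. M i j)"
    by (rule sum.swap)
  finally show ?thesis
    by (simp add: VM_dim_def distinct_card[OF distinct_VM_basis])
qed

lemma card_labels_class:
  assumes "i \<in> {1..k}" "j \<in> {1..l}"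
  shows "card {x\<in>labels. (fst x, fst (snd x)) = (i, j)} = M i j"
proof -
  have "{x\<in>labels. (fst x, fst (snd x)) = (i, j)} = (\<lambda>c. (i, j, c)) ` {..<M i j}"
    using assms by (auto simp: set_VM_basis)
  then show ?thesis
    by (simp add: card_image inj_on_def)
qed

end

text \<open>The two sums differ by the sum of \<open>a i * p i\<close>, which is half of
  \<open>p m\<close> squared plus the sum of the squares of the \<open>a i\<close>. Rewriting this
  with binomials cancels the linear terms, as \<open>p m\<close> is the sum of the
  \<open>a i\<close>.\<close>

lemma sum_squares_partial_sums:
  fixes a :: "nat \<Rightarrow> nat"
  defines "p \<equiv> \<lambda>m. \<Sum>i=1..m. a i"
  shows "(\<Sum>i=1..m. p i * p i) = (\<Sum>i=1..m. p (i - 1) * p i) + nbin a m + (Suc (p m) choose 2)"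
proof (induction m)
  case 0
  show ?case
    by (simp add: p_def nbin_def)
next
  case (Suc m)
  have p_Suc: "p (Suc m) = p m + a (Suc m)"
    by (simp add: p_def)
  have binom: "(Suc x choose 2) + y * (x + y) = (y choose 2) + (Suc (x + y) choose 2)" for x y :: nat
  proof (induction y)
    case (Suc y)
    then show ?case
      by (simp add: numeral_2_eq_2 algebra_simps)
  qed simp
  show ?case
    using Suc binom[of "p m" "a (Suc m)"] by (simp add: p_Suc nbin_def algebra_simps)
qed

context VM_setup
begin

text \<open>The Euler form of the dimension vector of \<open>V\<^sub>M\<close> with itself, written without
  subtraction. Each branch of the quiver contributes to it through the telescoping sum
  \<open>sum_squares_partial_sums\<close>.\<close>

lemma euler_form:
  assumes rows: "\<And>i. i \<in> {1..k} \<Longrightarrow> (\<Sum>j=1..l. M i j) = alpha i"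
    and cols: "\<And>j. j \<in> {1..l} \<Longrightarrow> (\<Sum>i=1..k. M i j) = beta j"
    and n: "(\<Sum>i=1..k. alpha i) = n" "(\<Sum>j=1..l. beta j) = n"
  shows "(\<Sum>v\<in>vert k l. dimv v * dimv v)
    = (\<Sum>w\<in>arrs k l. dimv w * dimv (tgt w)) + (n + nbin alpha k + nbin beta l)"
proof -
  define a where "a m = (\<Sum>i=1..m. alpha i)" for m
  define b where "b m = (\<Sum>j=1..m. beta j)" for m
  have da: "dimv (int k - int i) = a i" if "i \<in> {1..k}" for i
    using that rows unfolding dimv_nonneg[OF that] a_def by (intro sum.cong) auto
  have db: "dimv (int j - int l) = b j" if "j \<in> {1..l}" for j
    using that cols unfolding dimv_nonpos[OF that] b_def by (intro sum.cong) auto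
  have d0: "dimv 0 = n"
    using da[of k] kl n by (simp add: a_def)
  have va: "(\<Sum>v\<in>{0..int k - 1}. dimv v * dimv v) = (\<Sum>i=1..k. a i * a i)"
  proof (rule sum.reindex_bij_witness[of _ "\<lambda>i. int k - int i" "\<lambda>v. nat (int k - v)"])
    fix v assume v: "v \<in> {0..int k - 1}"
    define i where "i = nat (int k - v)"
    have "v = int k - int i" "i \<in> {1..k}"
      using v by (auto simp: i_def)
    then show "a (nat (int k - v)) * a (nat (int k - v)) = dimv v * dimv v"
      using da[of i] by (simp add: i_def[symmetric])
  qed auto
  have vb: "(\<Sum>v\<in>{1 - int l..0}. dimv v * dimv v) = (\<Sum>j=1..l. b j * b j)"
  proof (rule sum.reindex_bij_witness[of _ "\<lambda>j. int j - int l" "\<lambda>v. nat (v + int l)"])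
    fix v assume v: "v \<in> {1 - int l..0}"
    define i where "i = nat (v + int l)"
    have "v = int i - int l" "i \<in> {1..l}"
      using v by (auto simp: i_def)
    then show "b (nat (v + int l)) * b (nat (v + int l)) = dimv v * dimv v"
      using db[of i] by (simp add: i_def[symmetric])
  qed auto
  have wa: "(\<Sum>w\<in>{1..int k - 1}. dimv w * dimv (tgt w)) = (\<Sum>i=1..k. a (i - 1) * a i)"
  proof -
    have "(\<Sum>w\<in>{1..int k - 1}. dimv w * dimv (tgt w)) = (\<Sum>i=2..k. a (i - 1) * a i)"
    proof (rule sum.reindex_bij_witness[of _ "\<lambda>i. int k - int i + 1" "\<lambda>w. nat (int k - w) + 1"])
      fix w assume w: "w \<in> {1..int k - 1}"
      define i where "i = nat (int k - w)"
      have "w = int k - int i" "tgt w = int k - int (Suc i)" "i \<in> {1..k}" "Suc i \<in> {1..k}"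
        using w by (auto simp: i_def tgt_def)
      then show "a (nat (int k - w) + 1 - 1) * a (nat (int k - w) + 1) = dimv w * dimv (tgt w)"
        using da[of i] da[of "Suc i"] by (simp add: i_def[symmetric])
    qed auto
    \<comment> \<open>The added term at i = 1 vanishes because \<open>a 0\<close> is an empty
      sum.\<close>
    also have "\<dots> = (\<Sum>i=1..k. a (i - 1) * a i)"
      using sum.atLeast_Suc_atMost[of 1 k "\<lambda>i. a (i - 1) * a i"] kl
      by (simp add: numeral_2_eq_2 a_def[of 0])
    finally show ?thesis .
  qed
  have wb: "(\<Sum>w\<in>{1 - int l..-1}. dimv w * dimv (tgt w)) = (\<Sum>j=1..l. b (j - 1) * b j)"
  proof -
    have "(\<Sum>w\<in>{1 - int l..-1}. dimv w * dimv (tgt w)) = (\<Sum>j=2..l. b (j - 1) * b j)"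
    proof (rule sum.reindex_bij_witness[of _ "\<lambda>j. int j - int l - 1" "\<lambda>w. nat (w + int l) + 1"])
      fix w assume w: "w \<in> {1 - int l..-1}"
      define j where "j = nat (w + int l)"
      have "w = int j - int l" "tgt w = int (Suc j) - int l" "j \<in> {1..l}" "Suc j \<in> {1..l}"
        using w by (auto simp: j_def tgt_def)
      then show "b (nat (w + int l) + 1 - 1) * b (nat (w + int l) + 1) = dimv w * dimv (tgt w)"
        using db[of j] db[of "Suc j"] by (simp add: j_def[symmetric])
    qed auto
    also have "\<dots> = (\<Sum>j=1..l. b (j - 1) * b j)"
      using sum.atLeast_Suc_atMost[of 1 l "\<lambda>j. b (j - 1) * b j"] kl
      by (simp add: numeral_2_eq_2 b_def[of 0])
    finally show ?thesis .
  qed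
  have vert: "vert k l = {0..int k - 1} \<union> ({1 - int l..0} - {0})"
    and arrs: "arrs k l = {1..int k - 1} \<union> {1 - int l..-1}"
    using kl by (auto simp: vert_def arrs_def)
  have "(\<Sum>v\<in>vert k l. dimv v * dimv v) = (\<Sum>v\<in>{0..int k - 1}. dimv v * dimv v)
      + (\<Sum>v\<in>{1 - int l..0} - {0}. dimv v * dimv v)"
    unfolding vert by (rule sum.union_disjoint) auto
  moreover have "(\<Sum>v\<in>{1 - int l..0}. dimv v * dimv v) = n * n + (\<Sum>v\<in>{1 - int l..0} - {0}. dimv v * dimv v)"
    using kl d0 by (subst sum.remove[of _ 0]) auto
  moreover have "(\<Sum>w\<in>arrs k l. dimv w * dimv (tgt w))
      = (\<Sum>w\<in>{1..int k - 1}. dimv w * dimv (tgt w)) + (\<Sum>w\<in>{1 - int l..-1}. dimv w * dimv (tgt w))"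
    unfolding arrs by (rule sum.union_disjoint) auto
  moreover have "(\<Sum>i=1..k. a i * a i) = (\<Sum>i=1..k. a (i - 1) * a i) + nbin alpha k + (Suc n choose 2)"
    using sum_squares_partial_sums[of alpha k] n unfolding a_def by simp
  moreover have "(\<Sum>j=1..l. b j * b j) = (\<Sum>j=1..l. b (j - 1) * b j) + nbin beta l + (Suc n choose 2)"
    using sum_squares_partial_sums[of beta l] n unfolding b_def by simp
  \<comment> \<open>Each branch contributes one binomial, and vertex 0, shared by both branches, is
    to be counted once: removing n^2 from n^2 + n leaves the summand n of the exponent.\<close>
  moreover have "2 * (Suc n choose 2) = n * n + n"
    by (simp add: choose_two)
  ultimately show ?thesis
    using va vb wa wb by linarith
qed

end

text \<open>Each q-integer is a geometric sum equal to (1 - q^r) / (1 - q); this converts the unit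
  proportion of a block into a q-factorial.\<close>

lemma qfact_mult_power:
  "qfact q m * (1 - q) ^ m = (\<Prod>r=1..m. 1 - q ^ r)"
proof -
  have "qfact q m * (1 - q) ^ m = (\<Prod>r=1..m. (\<Sum>s<r. q ^ s) * (1 - q))"
    by (simp add: qfact_def prod.distrib)
  also have "\<dots> = (\<Prod>r=1..m. 1 - q ^ r)"
    by (simp add: one_diff_power_eq mult.commute)
  finally show ?thesis .
qed

theorem theorem8p33:
  fixes T :: "'a::{finite, field} itself"
    and k l n :: nat and alpha beta :: "nat \<Rightarrow> nat" and M :: "nat \<Rightarrow> nat \<Rightarrow> nat"
    and q :: real
  assumes "k \<ge> 1" and "l \<ge> 1"
    and "q = 1 / real (card (UNIV :: 'a set))"
    and "(\<Sum>i=1..k. alpha i) = n" and "(\<Sum>j=1..l. beta j) = n"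
    and "\<forall>i\<in>{1..k}. (\<Sum>j=1..l. M i j) = alpha i"
    and "\<forall>j\<in>{1..l}. (\<Sum>i=1..k. M i j) = beta j"
  shows "mass k l M T =
    q ^ (n + nbin alpha k + nbin beta l) * (1 - q) powi (- int n)
      / (\<Prod>i=1..k. \<Prod>j=1..l. qfact q (M i j))"
proof -
  interpret VM_setup k l M
    by unfold_locales (rule assms(1,2))+
  let ?Q = "real CARD('a)" and ?E = "n + nbin alpha k + nbin beta l"
  let ?inc = "inc labels label_le :: (nat \<times> nat \<times> nat \<Rightarrow> nat \<times> nat \<times> nat \<Rightarrow> 'a) set"
  let ?P = "\<Prod>i=1..k. \<Prod>j=1..l. qfact q (M i j)"
  have "card {0, 1 :: 'a} \<le> CARD('a)"
    by (rule card_mono) auto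
  then have Q: "?Q > 1"
    by simp
  then have q: "0 < q" "q < 1"
    by (simp_all add: assms(3))
  have inc0: "real (card ?inc) \<noteq> 0"
    by (simp add: card_inc(2))
  have units: "real (card (inc_units labels label_le :: (nat \<times> nat \<times> nat \<Rightarrow> nat \<times> nat \<times> nat \<Rightarrow> 'a) set))
      = real (card ?inc) * (?P * (1 - q) ^ n)"
  proof -
    have "real (card (inc_units labels label_le :: (nat \<times> nat \<times> nat \<Rightarrow> nat \<times> nat \<times> nat \<Rightarrow> 'a) set))
        = real (card ?inc) * (\<Prod>c\<in>{1..k} \<times> {1..l}.
          \<Prod>r=1..card {x\<in>labels. (fst x, fst (snd x)) = c}. 1 - (1 / ?Q) ^ r)"
    proof (rule card_inc_units)
      show "(\<lambda>x. (fst x, fst (snd x))) ` labels \<subseteq> {1..k} \<times> {1..l}"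
        by (auto simp: set_VM_basis)
    qed (auto simp: reflp_def transp_def label_le_def)
    also have "(\<Prod>c\<in>{1..k} \<times> {1..l}. \<Prod>r=1..card {x\<in>labels. (fst x, fst (snd x)) = c}. 1 - (1 / ?Q) ^ r)
        = (\<Prod>c\<in>{1..k} \<times> {1..l}. qfact q (M (fst c) (snd c)) * (1 - q) ^ M (fst c) (snd c))"
    proof (rule prod.cong[OF refl])
      fix c assume "c \<in> {1..k} \<times> {1..l}"
      then have "card {x\<in>labels. (fst x, fst (snd x)) = c} = M (fst c) (snd c)"
        using card_labels_class[of "fst c" "snd c"] by auto
      then show "(\<Prod>r=1..card {x\<in>labels. (fst x, fst (snd x)) = c}. 1 - (1 / ?Q) ^ r)
          = qfact q (M (fst c) (snd c)) * (1 - q) ^ M (fst c) (snd c)"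
        by (simp add: qfact_mult_power assms(3))
    qed
    also have "\<dots> = (\<Prod>i=1..k. \<Prod>j=1..l. qfact q (M i j) * (1 - q) ^ M i j)"
      by (simp add: prod.cartesian_product case_prod_unfold)
    also have "\<dots> = ?P * (1 - q) ^ (\<Sum>i=1..k. \<Sum>j=1..l. M i j)"
      by (simp add: prod.distrib power_sum)
    also have "(\<Sum>i=1..k. \<Sum>j=1..l. M i j) = n"
      unfolding assms(4)[symmetric] by (rule sum.cong) (use assms(6) in auto)
    finally show ?thesis .
  qed
  have euler: "(\<Sum>v\<in>vert k l. dimv v * dimv v) = (\<Sum>w\<in>arrs k l. dimv w * dimv (tgt w)) + ?E"
    by (rule euler_form) (use assms in auto)
  have "mass k l M T = ?Q ^ (\<Sum>w\<in>arrs k l. dimv w * dimv (tgt w)) * real (card ?inc)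
      / (?Q ^ (\<Sum>v\<in>vert k l. dimv v * dimv v) * (real (card ?inc) * (?P * (1 - q) ^ n)))"
    using mass_eq[OF VM_reps, where 'a = 'a]
    unfolding mass_def iso_classes_def mods_over_def card_Aut_VM units bij_betw_same_card[OF bij_to_inc] .
  \<comment> \<open>The order of the endomorphism algebra cancels, and the two powers of Q differ
    exactly by the Euler form.\<close>
  also have "\<dots> = 1 / ?Q ^ ?E / (?P * (1 - q) ^ n)"
    using Q inc0 by (simp add: euler power_add)
  also have "1 / ?Q ^ ?E = q ^ ?E"
    by (simp add: assms(3) power_one_over)
  also have "q ^ ?E / (?P * (1 - q) ^ n) = q ^ ?E * (1 - q) powi (- int n) / ?P"
    by (simp add: power_int_minus divide_simps)
  finally show ?thesis .
qed

end
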